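(* Any nilpotent subgroup of a diagram group is abelian.
   Context: Diagram groups. A semigroup presentation $\mathcal{P}=\langle\Sigma\mid\mathcal{R}\rangle$ consists of an alphabet $\Sigma$ and a set $\mathcal{R}$ of pairs $(u,v)$ of non-empty words over $\Sigma$, written $u=v$; presentations are assumed anti-symmetric: if $(u=v)\in\mathcal{R}$ then $(v=u)\notin\mathcal{R}$. $\Sigma^+$ and $\Sigma^*$ are the free semigroup and free monoid on $\Sigma$. The graph $\Gamma(\mathcal{P})$ has vertex set $\Sigma^+$ and an edge $(p,u\to v,q)$ from $puq$ to $pvq$ for all $p,q\in\Sigma^*$ and all $u,v$ with $(u=v)\in\mathcal{R}$ or $(v=u)\in\mathcal{R}$; the inverse edge is $(p,v\to u,q)$. The Squier complex $\mathcal{K}(\mathcal{P})$ is the 2-complex obtained from $\Gamma(\mathcal{P})$ by attaching, for all $p,z,q\in\Sigma^*$ and $(\ell_1=r_1),(\ell_2=r_2)\in\mathcal{R}$, a 2-cell along the closed path $p_1p_2^{-1}$, where $p_1=(p,\ell_1\to r_1,z\ell_2q)(pr_1z,\ell_2\to r_2,q)$ and $p_2=(p\ell_1z,\ell_2\to r_2,q)(p,\ell_1\to r_1,zr_2q)$. For $w\in\Sigma^+$ the diagram group $\mathcal{D}(\mathcal{P},w)$ is (up to isomorphism, by Kilibarda's theorem; this may be taken as the definition) the fundamental group $\pi_1(\mathcal{K}(\mathcal{P}),w)$. A group is a diagram group if it is isomorphic to some $\mathcal{D}(\mathcal{P},w)$. *)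

theory Defs
  imports "HOL-Algebra.Generated_Groups"
begin

section \<open>Semigroup presentations\<close>

abbreviation free_semigroup :: "'a set \<Rightarrow> 'a list set" where
  "free_semigroup \<Sigma> \<equiv> lists \<Sigma> - {[]}"

definition semigroup_presentation :: "'a set \<Rightarrow> ('a list \<times> 'a list) set \<Rightarrow> bool" where
  "semigroup_presentation \<Sigma> R \<longleftrightarrow>
     R \<subseteq> free_semigroup \<Sigma> \<times> free_semigroup \<Sigma> \<and>
     (\<forall>u v. (u, v) \<in> R \<longrightarrow> (v, u) \<notin> R)"


section \<open>The Squier complex\<close>

text \<open>A tuple \<open>(p, u, v, q)\<close> encodes the edge \<open>(p, u \<rightarrow> v, q)\<close> from \<open>puq\<close> to \<open>pvq\<close>.\<close>

type_synonym 'a edge = "'a list \<times> 'a list \<times> 'a list \<times> 'a list"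

fun edge_source :: "'a edge \<Rightarrow> 'a list" where
  "edge_source (p, u, v, q) = p @ u @ q"

fun edge_target :: "'a edge \<Rightarrow> 'a list" where
  "edge_target (p, u, v, q) = p @ v @ q"

fun edge_inverse :: "'a edge \<Rightarrow> 'a edge" where
  "edge_inverse (p, u, v, q) = (p, v, u, q)"

definition edges :: "'a set \<Rightarrow> ('a list \<times> 'a list) set \<Rightarrow> 'a edge set" where
  "edges \<Sigma> R = {(p, u, v, q) | p u v q.
     p \<in> lists \<Sigma> \<and> q \<in> lists \<Sigma> \<and> ((u, v) \<in> R \<or> (v, u) \<in> R)}"

text \<open>\<open>is_path \<Sigma> R x \<gamma> y\<close>: \<open>\<gamma>\<close> is an edge path in the graph from \<open>x\<close> to \<open>y\<close>.\<close>

fun is_path :: "'a set \<Rightarrow> ('a list \<times> 'a list) set \<Rightarrow> 'a list \<Rightarrow> 'a edge list \<Rightarrow> 'a list \<Rightarrow> bool" where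
  "is_path \<Sigma> R x [] y \<longleftrightarrow> x \<in> free_semigroup \<Sigma> \<and> x = y"
| "is_path \<Sigma> R x (e # \<gamma>) y \<longleftrightarrow>
     x \<in> free_semigroup \<Sigma> \<and> e \<in> edges \<Sigma> R \<and> edge_source e = x \<and> is_path \<Sigma> R (edge_target e) \<gamma> y"

definition path_inverse :: "'a edge list \<Rightarrow> 'a edge list" where
  "path_inverse \<gamma> = rev (map edge_inverse \<gamma>)"

definition cell_boundaries :: "'a set \<Rightarrow> ('a list \<times> 'a list) set \<Rightarrow> 'a edge list set" where
  "cell_boundaries \<Sigma> R =
     {[(p, l1, r1, z @ l2 @ q), (p @ r1 @ z, l2, r2, q)] @
      path_inverse [(p @ l1 @ z, l2, r2, q), (p, l1, r1, z @ r2 @ q)] | p z q l1 r1 l2 r2.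
      p \<in> lists \<Sigma> \<and> z \<in> lists \<Sigma> \<and> q \<in> lists \<Sigma> \<and> (l1, r1) \<in> R \<and> (l2, r2) \<in> R}"

text \<open>Homotopy with fixed endpoints of edge paths in the 2-complex: backtracks and boundaries
  of 2-cells may be inserted and deleted.  All other boundary words of a 2-cell (cyclic
  shifts and inverses) are then null-homotopic as well.\<close>

inductive homotopic ::
    "'a set \<Rightarrow> ('a list \<times> 'a list) set \<Rightarrow> 'a list \<Rightarrow> 'a list \<Rightarrow> 'a edge list \<Rightarrow> 'a edge list \<Rightarrow> bool"
  for \<Sigma> R x y where
    refl: "is_path \<Sigma> R x \<gamma> y \<Longrightarrow> homotopic \<Sigma> R x y \<gamma> \<gamma>"
  | sym: "homotopic \<Sigma> R x y \<gamma> \<delta> \<Longrightarrow> homotopic \<Sigma> R x y \<delta> \<gamma>"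
  | trans: "homotopic \<Sigma> R x y \<gamma> \<delta> \<Longrightarrow> homotopic \<Sigma> R x y \<delta> \<epsilon> \<Longrightarrow> homotopic \<Sigma> R x y \<gamma> \<epsilon>"
  | backtrack: "is_path \<Sigma> R x (\<gamma> @ [e, edge_inverse e] @ \<delta>) y \<Longrightarrow>
      homotopic \<Sigma> R x y (\<gamma> @ [e, edge_inverse e] @ \<delta>) (\<gamma> @ \<delta>)"
  | cell: "c \<in> cell_boundaries \<Sigma> R \<Longrightarrow> is_path \<Sigma> R x (\<gamma> @ c @ \<delta>) y \<Longrightarrow>
      homotopic \<Sigma> R x y (\<gamma> @ c @ \<delta>) (\<gamma> @ \<delta>)"


section \<open>Diagram groups\<close>

definition homotopy_rel ::
    "'a set \<Rightarrow> ('a list \<times> 'a list) set \<Rightarrow> 'a list \<Rightarrow> ('a edge list \<times> 'a edge list) set" where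
  "homotopy_rel \<Sigma> R w = {(\<gamma>, \<delta>). homotopic \<Sigma> R w w \<gamma> \<delta>}"

definition diagram_group ::
    "'a set \<Rightarrow> ('a list \<times> 'a list) set \<Rightarrow> 'a list \<Rightarrow> 'a edge list set monoid" where
  "diagram_group \<Sigma> R w =
     \<lparr> carrier = {\<gamma>. is_path \<Sigma> R w \<gamma> w} // homotopy_rel \<Sigma> R w,
       mult = (\<lambda>A B. \<Union>\<gamma>\<in>A. \<Union>\<delta>\<in>B. homotopy_rel \<Sigma> R w `` {\<gamma> @ \<delta>}),
       one = homotopy_rel \<Sigma> R w `` {[]} \<rparr>"


section \<open>Nilpotent groups\<close>

fun lower_central_series :: "('g, 'b) monoid_scheme \<Rightarrow> nat \<Rightarrow> 'g set" where
  "lower_central_series G 0 = carrier G"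
| "lower_central_series G (Suc n) = generate G
     {h \<otimes>\<^bsub>G\<^esub> g \<otimes>\<^bsub>G\<^esub> inv\<^bsub>G\<^esub> h \<otimes>\<^bsub>G\<^esub> inv\<^bsub>G\<^esub> g | h g. h \<in> lower_central_series G n \<and> g \<in> carrier G}"

definition nilpotent_group :: "('g, 'b) monoid_scheme \<Rightarrow> bool" where
  "nilpotent_group G \<longleftrightarrow> group G \<and> (\<exists>n. lower_central_series G n = {\<one>\<^bsub>G\<^esub>})"


section \<open>The diagram group is a group\<close>

lemma is_path_start: "is_path \<Sigma> R x \<gamma> y \<Longrightarrow> x \<in> free_semigroup \<Sigma>"
  by (cases \<gamma>) auto

lemma is_path_append:
  "is_path \<Sigma> R x (\<gamma> @ \<delta>) y \<longleftrightarrow> (\<exists>z. is_path \<Sigma> R x \<gamma> z \<and> is_path \<Sigma> R z \<delta> y)"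
  by (induction \<gamma> arbitrary: x) (auto dest: is_path_start)

lemma is_path_end: "is_path \<Sigma> R x \<gamma> y \<Longrightarrow> y \<in> free_semigroup \<Sigma>"
  by (induction \<gamma> arbitrary: x) auto

lemma edge_inverse_simps [simp]:
  "edge_inverse (edge_inverse e) = e"
  "edge_source (edge_inverse e) = edge_target e"
  "edge_target (edge_inverse e) = edge_source e"
  "edge_inverse e \<in> edges \<Sigma> R \<longleftrightarrow> e \<in> edges \<Sigma> R"
  by (cases e; auto simp: edges_def)+

lemma backtrack_closed: "is_path \<Sigma> R x [e, edge_inverse e] y \<Longrightarrow> x = y"
  by auto

lemma cell_closed: "c \<in> cell_boundaries \<Sigma> R \<Longrightarrow> is_path \<Sigma> R x c y \<Longrightarrow> x = y"
  by (auto simp: cell_boundaries_def path_inverse_def)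

lemma is_path_delete:
  assumes "is_path \<Sigma> R x (\<gamma> @ c @ \<delta>) y" "\<And>x y. is_path \<Sigma> R x c y \<Longrightarrow> x = y"
  shows "is_path \<Sigma> R x (\<gamma> @ \<delta>) y"
  using assms unfolding is_path_append by metis

lemma homotopic_is_path:
  "homotopic \<Sigma> R x y \<gamma> \<delta> \<Longrightarrow> is_path \<Sigma> R x \<gamma> y \<and> is_path \<Sigma> R x \<delta> y"
proof (induction rule: homotopic.induct)
  case (backtrack \<gamma> e \<delta>)
  then show ?case
    using is_path_delete[of \<Sigma> R x \<gamma> "[e, edge_inverse e]" \<delta> y] backtrack_closed by blast
next
  case (cell c \<gamma> \<delta>)
  then show ?case
    using is_path_delete[of \<Sigma> R x \<gamma> c \<delta> y] cell_closed by blast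
qed auto

lemma homotopic_context:
  assumes "homotopic \<Sigma> R x y \<gamma> \<delta>" "is_path \<Sigma> R x' \<alpha> x" "is_path \<Sigma> R y \<beta> y'"
  shows "homotopic \<Sigma> R x' y' (\<alpha> @ \<gamma> @ \<beta>) (\<alpha> @ \<delta> @ \<beta>)"
  using assms
proof (induction rule: homotopic.induct)
  case (refl \<gamma>)
  then show ?case by (intro homotopic.refl) (auto simp: is_path_append)
next
  case (sym \<gamma> \<delta>)
  then show ?case by (blast intro: homotopic.sym)
next
  case (trans \<gamma> \<delta> \<epsilon>)
  then show ?case by (blast intro: homotopic.trans)
next
  case (backtrack \<gamma> e \<delta>)
  then have "is_path \<Sigma> R x' (\<alpha> @ (\<gamma> @ [e, edge_inverse e] @ \<delta>) @ \<beta>) y'"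
    unfolding is_path_append[of _ _ _ \<alpha>] is_path_append[of _ _ _ _ \<beta>] by blast
  then show ?case using homotopic.backtrack[of \<Sigma> R x' "\<alpha> @ \<gamma>" e "\<delta> @ \<beta>" y'] by simp
next
  case (cell c \<gamma> \<delta>)
  then have "is_path \<Sigma> R x' (\<alpha> @ (\<gamma> @ c @ \<delta>) @ \<beta>) y'"
    unfolding is_path_append[of _ _ _ \<alpha>] is_path_append[of _ _ _ _ \<beta>] by blast
  then show ?case using homotopic.cell[of c \<Sigma> R x' "\<alpha> @ \<gamma>" "\<delta> @ \<beta>" y'] cell(1) by simp
qed

lemma homotopic_append:
  assumes "homotopic \<Sigma> R x y \<gamma> \<gamma>'" "homotopic \<Sigma> R y z \<delta> \<delta>'"
  shows "homotopic \<Sigma> R x z (\<gamma> @ \<delta>) (\<gamma>' @ \<delta>')"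
proof -
  have p: "is_path \<Sigma> R x \<gamma>' y" "is_path \<Sigma> R y \<delta> z"
    using assms homotopic_is_path by blast+
  then have "is_path \<Sigma> R x [] x" "is_path \<Sigma> R z [] z"
    using is_path_start[OF p(1)] is_path_end[OF p(2)] by auto
  with homotopic_context[OF assms(1) _ p(2)] homotopic_context[OF assms(2) p(1)]
  have "homotopic \<Sigma> R x z (\<gamma> @ \<delta>) (\<gamma>' @ \<delta>)" "homotopic \<Sigma> R x z (\<gamma>' @ \<delta>) (\<gamma>' @ \<delta>')"
    by fastforce+
  then show ?thesis by (rule homotopic.trans)
qed

lemma is_path_inverse:
  assumes "is_path \<Sigma> R x \<gamma> y"
  shows "is_path \<Sigma> R y (path_inverse \<gamma>) x"
  using assms
proof (induction \<gamma> arbitrary: x)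
  case Nil
  then show ?case by (auto simp: path_inverse_def)
next
  case (Cons e \<gamma>)
  then have "is_path \<Sigma> R (edge_target e) [edge_inverse e] x"
    by (auto dest: is_path_start)
  moreover have "is_path \<Sigma> R y (path_inverse \<gamma>) (edge_target e)"
    using Cons by auto
  ultimately show ?case
    unfolding path_inverse_def by (auto simp: is_path_append)
qed

lemma homotopic_inverse_left:
  "is_path \<Sigma> R x \<gamma> y \<Longrightarrow> homotopic \<Sigma> R y y (path_inverse \<gamma> @ \<gamma>) []"
proof (induction \<gamma> arbitrary: x)
  case Nil
  then show ?case by (auto simp: path_inverse_def intro: homotopic.refl)
next
  case (Cons e \<gamma>)
  have "is_path \<Sigma> R y (path_inverse (e # \<gamma>) @ (e # \<gamma>)) y"
    using Cons.prems is_path_inverse is_path_append by blast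
  then have "homotopic \<Sigma> R y y (path_inverse (e # \<gamma>) @ (e # \<gamma>)) (path_inverse \<gamma> @ \<gamma>)"
    using homotopic.backtrack[of \<Sigma> R y "path_inverse \<gamma>" "edge_inverse e" \<gamma> y]
    by (simp add: path_inverse_def)
  then show ?case using Cons by (auto intro: homotopic.trans)
qed

lemma equiv_homotopy_rel: "equiv {\<gamma>. is_path \<Sigma> R w \<gamma> w} (homotopy_rel \<Sigma> R w)"
  by (rule equivI)
    (auto simp: homotopy_rel_def refl_on_def sym_def trans_def
      dest: homotopic_is_path intro: homotopic.refl homotopic.sym homotopic.trans)

lemma diagram_group_mult_class:
  assumes "is_path \<Sigma> R w \<gamma> w" "is_path \<Sigma> R w \<delta> w"
  shows "homotopy_rel \<Sigma> R w `` {\<gamma>} \<otimes>\<^bsub>diagram_group \<Sigma> R w\<^esub> homotopy_rel \<Sigma> R w `` {\<delta>} =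
    homotopy_rel \<Sigma> R w `` {\<gamma> @ \<delta>}"
proof -
  have "congruent2 (homotopy_rel \<Sigma> R w) (homotopy_rel \<Sigma> R w)
      (\<lambda>\<gamma> \<delta>. homotopy_rel \<Sigma> R w `` {\<gamma> @ \<delta>})"
    by (rule congruent2I')
      (rule equiv_class_eq[OF equiv_homotopy_rel], simp add: homotopy_rel_def homotopic_append)
  from UN_equiv_class2[OF equiv_homotopy_rel equiv_homotopy_rel this, of \<gamma> \<delta>] assms
  show ?thesis by (simp add: diagram_group_def)
qed

lemma diagram_group_carrierE:
  assumes "A \<in> carrier (diagram_group \<Sigma> R w)"
  obtains \<gamma> where "is_path \<Sigma> R w \<gamma> w" "A = homotopy_rel \<Sigma> R w `` {\<gamma>}"
  using assms by (auto simp: diagram_group_def elim: quotientE)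

lemma diagram_group_class_in_carrier:
  "is_path \<Sigma> R w \<gamma> w \<Longrightarrow> homotopy_rel \<Sigma> R w `` {\<gamma>} \<in> carrier (diagram_group \<Sigma> R w)"
  by (auto simp: diagram_group_def intro: quotientI)

theorem group_diagram_group:
  assumes "w \<in> free_semigroup \<Sigma>"
  shows "group (diagram_group \<Sigma> R w)"
proof (rule groupI)
  let ?D = "diagram_group \<Sigma> R w" and ?c = "\<lambda>\<gamma>. homotopy_rel \<Sigma> R w `` {\<gamma>}"
  have one: "\<one>\<^bsub>?D\<^esub> = ?c []" by (simp add: diagram_group_def)
  have nil: "is_path \<Sigma> R w [] w" using assms by simp
  have app: "is_path \<Sigma> R w (\<gamma> @ \<delta>) w" if "is_path \<Sigma> R w \<gamma> w" "is_path \<Sigma> R w \<delta> w" for \<gamma> \<delta>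
    using that is_path_append by blast
  show "\<one>\<^bsub>?D\<^esub> \<in> carrier ?D"
    using one diagram_group_class_in_carrier[OF nil] by simp
  show "A \<otimes>\<^bsub>?D\<^esub> B \<in> carrier ?D" if "A \<in> carrier ?D" "B \<in> carrier ?D" for A B
    using that by (elim diagram_group_carrierE)
      (simp add: diagram_group_mult_class diagram_group_class_in_carrier app)
  show "A \<otimes>\<^bsub>?D\<^esub> B \<otimes>\<^bsub>?D\<^esub> C = A \<otimes>\<^bsub>?D\<^esub> (B \<otimes>\<^bsub>?D\<^esub> C)"
    if "A \<in> carrier ?D" "B \<in> carrier ?D" "C \<in> carrier ?D" for A B C
    using that by (elim diagram_group_carrierE) (simp add: diagram_group_mult_class app)
  show "\<one>\<^bsub>?D\<^esub> \<otimes>\<^bsub>?D\<^esub> A = A" if "A \<in> carrier ?D" for A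
    using that
    by (elim diagram_group_carrierE) (simp only: one diagram_group_mult_class nil append_Nil)
  show "\<exists>B\<in>carrier ?D. B \<otimes>\<^bsub>?D\<^esub> A = \<one>\<^bsub>?D\<^esub>" if A: "A \<in> carrier ?D" for A
  proof -
    obtain \<gamma> where g: "is_path \<Sigma> R w \<gamma> w" "A = ?c \<gamma>"
      using A by (rule diagram_group_carrierE)
    have "?c (path_inverse \<gamma> @ \<gamma>) = ?c []"
      using homotopic_inverse_left[OF g(1)]
      by (intro equiv_class_eq[OF equiv_homotopy_rel]) (simp add: homotopy_rel_def)
    then have "?c (path_inverse \<gamma>) \<otimes>\<^bsub>?D\<^esub> A = \<one>\<^bsub>?D\<^esub>"
      using g is_path_inverse[OF g(1)] by (simp only: diagram_group_mult_class one)
    then show ?thesis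
      using diagram_group_class_in_carrier[OF is_path_inverse[OF g(1)]] by blast
  qed
qed

end

theory Submission
  imports Defs
begin

text \<open>A nilpotent group that is not abelian contains elements \<open>x\<close>, \<open>y\<close> whose commutator
\<open>z = [x, y]\<close> is central and nontrivial.  Then \<open>z\<^bsup>n*n\<^esup> = [x\<^sup>n, y\<^sup>n]\<close> for all \<open>n\<close>
(\<open>pow_commutator\<close>), so the powers of \<open>z\<close> are distorted: \<open>z\<^bsup>n*n\<^esup>\<close> is represented by a path
of length \<open>O(n)\<close>.  In a diagram group this is impossible, because the powers of a nontrivial
element have linearly growing length (\<open>nontrivial_linear_growth\<close>).

Lengths are controlled through a concrete model of the universal cover of the Squier complex.
Every letter of a word remembers its history: it is either a letter of the initial word or the
\<open>i\<close>-th letter of the bottom side of a cell glued below a list of letters with histories.  An edge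
\<open>(p, u \<rightarrow> v, q)\<close> acts on such a decorated word by gluing a new cell, unless the affected letters
are the complete bottom of an inverse cell; in that case it removes this cell.  Independent edges
visibly commute and inverse edges cancel, so the action only depends on the homotopy class of a
path (\<open>act_homotopic\<close>).  Conversely, every path is homotopic to one that only glues cells
(\<open>creating_representative\<close>); such a path is geodesic, since the number of cells can be read off
from its final decorated word.  Replacing the letters of the initial word by those of another
decorated word gives a second action, by left multiplication, which commutes with the first one
(\<open>map_subst_act\<close>) and is injective (\<open>subst_inverse\<close>).

Linear growth for a loop \<open>\<gamma>\<close> is proved by induction on its length and on the length of its base
word; passing to a cyclic rotation of \<open>\<gamma>\<close>, that is, to a conjugate, is always allowed.  If \<open>\<gamma>\<close>
does not only glue cells, it can be shortened.  If no edge of \<open>\<gamma>\<close> touches the first letter, this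
letter can be dropped.  Otherwise \<open>\<gamma>\<close> may be assumed to start with an edge \<open>f\<close> at the first
letter, and if \<open>f\<close> removes a cell after \<open>\<gamma>\<close>, then moving \<open>f\<close> to the end of \<open>\<gamma>\<close> gives a loop that
can be shortened (\<open>rotation_prevents_cancellation\<close>).  If \<open>f\<close> still glues a cell after \<open>\<gamma>\<close>, then
the element given by \<open>\<gamma>\<close> acts as a translation on the tree formed by the possible first letters,
and the first letter of the decorated word of \<open>\<gamma>\<^sup>n\<close> lies below at least \<open>n\<close> cells
(\<open>linear_growth_at_first_letter\<close>).\<close>

section \<open>Decorated words\<close>

text \<open>\<open>Base i a\<close> is a letter \<open>a\<close> of the initial word, with \<open>i\<close> telling equal letters apart.
\<open>Out U v i\<close> is the \<open>i\<close>-th letter on the bottom side \<open>v\<close> of the cell glued below the letters \<open>U\<close>.\<close>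
datatype 'a letter = Base nat 'a | Out "'a letter list" "'a list" nat

primrec label :: "'a letter \<Rightarrow> 'a" where
  "label (Base i a) = a"
| "label (Out U v i) = v ! i"

abbreviation lab :: "'a letter list \<Rightarrow> 'a list" where
  "lab \<equiv> map label"

definition outs :: "'a letter list \<Rightarrow> 'a list \<Rightarrow> 'a letter list" where
  "outs U v = map (Out U v) [0..<length v]"

text \<open>The letters \<open>U\<close> are the whole bottom of a cell whose top reads \<open>v\<close>, so that replacing the label
of \<open>U\<close> by \<open>v\<close> undoes this cell.\<close>
definition cancelable :: "'a letter list \<Rightarrow> 'a list \<Rightarrow> bool" where
  "cancelable U v \<longleftrightarrow> (\<exists>U'. U = outs U' (lab U) \<and> lab U' = v)"

definition fire :: "'a letter list \<Rightarrow> 'a list \<Rightarrow> 'a letter list" where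
  "fire U v = (if cancelable U v then (THE U'. U = outs U' (lab U) \<and> lab U' = v) else outs U v)"

text \<open>The indices count from the right end of the word.  Dropping the first letter then leaves the
initial decorated word of the shorter word, which is what \<open>linear_growth_shift\<close> relies on.\<close>
fun start :: "'a list \<Rightarrow> 'a letter list" where
  "start [] = []"
| "start (a # x) = Base (length x) a # start x"

text \<open>Letters over the initial word \<open>b\<close> in whose history no cell has been glued directly below its own
inverse.\<close>
fun reduced :: "'a list \<Rightarrow> 'a letter \<Rightarrow> bool" where
  "reduced b (Base i a) \<longleftrightarrow> Base i a \<in> set (start b)"
| "reduced b (Out U v i) \<longleftrightarrow>
     (\<forall>L\<in>set U. reduced b L) \<and> U \<noteq> [] \<and> i < length v \<and> \<not> cancelable U v"

definition is_word :: "'a list \<Rightarrow> 'a letter list \<Rightarrow> 'a list \<Rightarrow> bool" where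
  "is_word b S x \<longleftrightarrow> lab S = x \<and> (\<forall>L\<in>set S. reduced b L)"

lemma length_outs [simp]: "length (outs U v) = length v"
  by (simp add: outs_def)

lemma outs_eq_Nil [simp]: "outs U v = [] \<longleftrightarrow> v = []"
  by (simp add: outs_def)

lemma nth_outs [simp]: "i < length v \<Longrightarrow> outs U v ! i = Out U v i"
  by (simp add: outs_def)

lemma lab_outs [simp]: "lab (outs U v) = v"
  by (rule nth_equalityI) auto

lemma hd_outs [simp]: "v \<noteq> [] \<Longrightarrow> hd (outs U v) = Out U v 0"
  by (simp add: hd_conv_nth)

lemma set_outs: "L \<in> set (outs U v) \<longleftrightarrow> (\<exists>i<length v. L = Out U v i)"
  by (auto simp: outs_def)

lemma outs_inject: "outs U v = outs U' v' \<Longrightarrow> v \<noteq> [] \<Longrightarrow> U = U' \<and> v = v'"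
  by (metis hd_outs outs_eq_Nil letter.inject(2))

lemma cancelable_outs [simp]: "v \<noteq> [] \<Longrightarrow> cancelable (outs U v) u \<longleftrightarrow> lab U = u"
  unfolding cancelable_def lab_outs using outs_inject by blast

lemma fire_outs: "v \<noteq> [] \<Longrightarrow> lab U = u \<Longrightarrow> fire (outs U v) u = U"
  unfolding fire_def cancelable_outs lab_outs
  by (simp, rule the_equality) (simp, metis outs_inject)

lemma fire_not_cancelable: "\<not> cancelable U v \<Longrightarrow> fire U v = outs U v"
  by (simp add: fire_def)

lemma cancelableE:
  assumes "cancelable U v" "U \<noteq> []"
  obtains U' where "U = outs U' (lab U)" "lab U' = v" "fire U v = U'"
proof -
  obtain U' where U': "U = outs U' (lab U)" "lab U' = v"
    using assms(1) by (auto simp: cancelable_def)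
  have "fire (outs U' (lab U)) v = U'"
    using assms(2) U'(2) by (intro fire_outs) auto
  then show ?thesis using U' that by metis
qed

lemma lab_fire:
  assumes "U \<noteq> []" shows "lab (fire U v) = v"
proof (cases "cancelable U v")
  case True
  then show ?thesis using assms by (metis cancelableE)
qed (simp add: fire_not_cancelable)

lemma length_fire: "U \<noteq> [] \<Longrightarrow> length (fire U v) = length v"
  by (metis lab_fire length_map)

text \<open>Reducedness is what makes firing invertible: if \<open>U\<close> is the bottom of a cell undone by firing
\<open>v\<close>, then firing back must glue this same cell again, and not undo a cell further up.\<close>
lemma fire_fire:
  assumes "\<forall>L\<in>set U. reduced b L" "U \<noteq> []" "v \<noteq> []"
  shows "fire (fire U v) (lab U) = U"
proof (cases "cancelable U v")
  case False
  then show ?thesis using assms(3) by (simp add: fire_not_cancelable fire_outs)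
next
  case True
  then obtain U' where U': "U = outs U' (lab U)" "lab U' = v" "fire U v = U'"
    using assms(2) by (rule cancelableE)
  have "reduced b (Out U' (lab U) 0)"
    using assms(1,2) U'(1) by (metis hd_in_set hd_outs map_is_Nil_conv)
  then show ?thesis using U' by (simp add: fire_not_cancelable)
qed

lemma reduced_fire:
  assumes "\<forall>L\<in>set U. reduced b L" "U \<noteq> []"
  shows "\<forall>L\<in>set (fire U v). reduced b L"
proof (cases "cancelable U v")
  case False
  then show ?thesis using assms by (auto simp: fire_not_cancelable set_outs)
next
  case True
  then obtain U' where U': "U = outs U' (lab U)" "lab U' = v" "fire U v = U'"
    using assms(2) by (rule cancelableE)
  have "reduced b (Out U' (lab U) 0)"
    using assms(1,2) U'(1) by (metis hd_in_set hd_outs map_is_Nil_conv)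
  then show ?thesis using U' by simp
qed

lemma length_start [simp]: "length (start x) = length x"
  by (induction x) auto

lemma lab_start [simp]: "lab (start x) = x"
  by (induction x) auto

lemma start_letter: "L \<in> set (start x) \<Longrightarrow> \<exists>i a. L = Base i a \<and> i < length x"
  by (induction x) auto

lemma is_word_start: "is_word x (start x) x"
  unfolding is_word_def by (auto dest: start_letter) (metis reduced.simps(1) start_letter)

text \<open>The initial word is indexed from the right, so a substitution for its letters looks up the
reversed word.\<close>
lemma nth_rev_start: "Base i a \<in> set (start x) \<Longrightarrow> rev (start x) ! i = Base i a \<and> rev x ! i = a"
proof (induction x)
  case (Cons c x)
  show ?case
  proof (cases "Base i a \<in> set (start x)")
    case True
    then have "i < length x" using start_letter by fastforce
    then show ?thesis using Cons.IH[OF True] by (simp add: nth_append)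
  next
    case False
    then show ?thesis using Cons.prems by (simp add: nth_append)
  qed
qed simp

lemma not_cancelable_Base:
  assumes "U \<noteq> []" "hd U = Base i a" shows "\<not> cancelable U v"
  using assms by (metis cancelable_def hd_outs letter.distinct(1) outs_eq_Nil)

section \<open>The action of edge paths on decorated words\<close>

fun act_edge :: "'a edge \<Rightarrow> 'a letter list \<Rightarrow> 'a letter list" where
  "act_edge (p, u, v, q) S =
     take (length p) S @ fire (take (length u) (drop (length p) S)) v @ drop (length p + length u) S"

fun cancels :: "'a edge \<Rightarrow> 'a letter list \<Rightarrow> bool" where
  "cancels (p, u, v, q) S \<longleftrightarrow> cancelable (take (length u) (drop (length p) S)) v"

abbreviation act :: "'a edge list \<Rightarrow> 'a letter list \<Rightarrow> 'a letter list" where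
  "act \<equiv> fold act_edge"

primrec creating :: "'a edge list \<Rightarrow> 'a letter list \<Rightarrow> bool" where
  "creating [] S \<longleftrightarrow> True"
| "creating (e # \<gamma>) S \<longleftrightarrow> \<not> cancels e S \<and> creating \<gamma> (act_edge e S)"

lemma creating_append: "creating (\<gamma> @ \<delta>) S \<longleftrightarrow> creating \<gamma> S \<and> creating \<delta> (act \<gamma> S)"
  by (induction \<gamma> arbitrary: S) auto

lemma act_edge_split:
  assumes "length P = length p" "length U = length u"
  shows "act_edge (p, u, v, q) (P @ U @ Q) = P @ fire U v @ Q"
  using assms by simp

lemma cancels_split:
  assumes "length P = length p" "length U = length u"
  shows "cancels (p, u, v, q) (P @ U @ Q) \<longleftrightarrow> cancelable U v"
  using assms by simp

declare act_edge.simps [simp del] cancels.simps [simp del]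

lemma word_split:
  assumes "is_word b S (x @ y)"
  obtains X Y where "S = X @ Y" "is_word b X x" "is_word b Y y"
  using assms unfolding is_word_def map_eq_append_conv by auto

lemma is_word_append: "is_word b X x \<Longrightarrow> is_word b Y y \<Longrightarrow> is_word b (X @ Y) (x @ y)"
  by (auto simp: is_word_def)

lemma is_word_length: "is_word b X x \<Longrightarrow> length X = length x"
  by (auto simp: is_word_def)

lemma is_word_fire: "is_word b U u \<Longrightarrow> u \<noteq> [] \<Longrightarrow> is_word b (fire U v) v"
  unfolding is_word_def using reduced_fire lab_fire by (metis map_is_Nil_conv)

lemma is_word_fire_fire: "is_word b U u \<Longrightarrow> u \<noteq> [] \<Longrightarrow> v \<noteq> [] \<Longrightarrow> fire (fire U v) u = U"
  unfolding is_word_def using fire_fire by (metis map_is_Nil_conv)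

locale presentation =
  fixes \<Sigma> :: "'a set" and R :: "('a list \<times> 'a list) set"
  assumes pres: "semigroup_presentation \<Sigma> R"
begin

lemma edge_sides:
  assumes "(p, u, v, q) \<in> edges \<Sigma> R"
  shows "u \<noteq> []" "v \<noteq> []" "u \<noteq> v" "u \<in> lists \<Sigma>" "v \<in> lists \<Sigma>" "p \<in> lists \<Sigma>" "q \<in> lists \<Sigma>"
proof -
  have e: "p \<in> lists \<Sigma>" "q \<in> lists \<Sigma>" "(u, v) \<in> R \<or> (v, u) \<in> R"
    using assms by (simp_all add: edges_def)
  have R: "\<And>a c. (a, c) \<in> R \<Longrightarrow> a \<in> free_semigroup \<Sigma> \<and> c \<in> free_semigroup \<Sigma>"
    and anti: "\<And>a c. (a, c) \<in> R \<Longrightarrow> (c, a) \<notin> R"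
    using pres unfolding semigroup_presentation_def by blast+
  have "u \<in> free_semigroup \<Sigma>" "v \<in> free_semigroup \<Sigma>" using e(3) R by blast+
  moreover have "u \<noteq> v" using e(3) anti by blast
  ultimately show "u \<noteq> []" "v \<noteq> []" "u \<noteq> v" "u \<in> lists \<Sigma>" "v \<in> lists \<Sigma>" "p \<in> lists \<Sigma>" "q \<in> lists \<Sigma>"
    using e(1,2) by simp_all
qed

lemma edge_splitE:
  assumes "e \<in> edges \<Sigma> R" "is_word b S (edge_source e)"
  obtains p u v q P U Q where "e = (p, u, v, q)" "S = P @ U @ Q" "is_word b P p" "is_word b U u"
    "is_word b Q q" "U \<noteq> []" "v \<noteq> []" "u \<noteq> v" "act_edge e S = P @ fire U v @ Q"
    "cancels e S \<longleftrightarrow> cancelable U v"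
proof -
  obtain p u v q where e: "e = (p, u, v, q)" by (metis prod.exhaust)
  obtain P S' where 1: "S = P @ S'" "is_word b P p" "is_word b S' (u @ q)"
    using assms(2) unfolding e edge_source.simps by (rule word_split)
  obtain U Q where 2: "S' = U @ Q" "is_word b U u" "is_word b Q q" using 1(3) by (rule word_split)
  have n: "u \<noteq> []" "v \<noteq> []" "u \<noteq> v" using assms(1) edge_sides unfolding e by blast+
  have "length P = length p" "length U = length u" using 1 2 is_word_length by blast+
  then have "act_edge e S = P @ fire U v @ Q" "cancels e S \<longleftrightarrow> cancelable U v"
    unfolding e 1 2 by (simp_all add: act_edge_split cancels_split)
  moreover have "U \<noteq> []" using n(1) 2(2) by (auto simp: is_word_def)
  ultimately show ?thesis using that[OF e _ 1(2) 2(2,3)] 1(1) 2(1) n by simp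
qed

lemma is_word_act_edge:
  assumes "e \<in> edges \<Sigma> R" "is_word b S (edge_source e)"
  shows "is_word b (act_edge e S) (edge_target e)"
proof -
  obtain p u v q P U Q where h: "e = (p, u, v, q)" "S = P @ U @ Q" "is_word b P p" "is_word b U u"
    "is_word b Q q" "U \<noteq> []" "v \<noteq> []" "act_edge e S = P @ fire U v @ Q"
    by (rule edge_splitE[OF assms]) (rule that)
  have "u \<noteq> []" using h(4,6) by (auto simp: is_word_def)
  then show ?thesis using h by (simp add: is_word_append is_word_fire)
qed

lemma is_word_act: "is_path \<Sigma> R x \<gamma> y \<Longrightarrow> is_word b S x \<Longrightarrow> is_word b (act \<gamma> S) y"
proof (induction \<gamma> arbitrary: x S)
  case (Cons e \<gamma>)
  then show ?case using is_word_act_edge[of e b S] by auto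
qed simp

lemma act_backtrack:
  assumes "e \<in> edges \<Sigma> R" "is_word b S (edge_source e)"
  shows "act_edge (edge_inverse e) (act_edge e S) = S"
proof -
  obtain p u v q P U Q where h: "e = (p, u, v, q)" "S = P @ U @ Q" "is_word b P p" "is_word b U u"
    "is_word b Q q" "U \<noteq> []" "v \<noteq> []" "act_edge e S = P @ fire U v @ Q"
    by (rule edge_splitE[OF assms]) (rule that)
  have u: "u \<noteq> []" "length U = length u" "length P = length p"
    using h(3,4,6) by (auto simp: is_word_def)
  have "length (fire U v) = length v" "fire (fire U v) u = U"
    using h(6,7) length_fire is_word_fire_fire[OF h(4) u(1) h(7)] by auto
  then show ?thesis using h(1,2,8) u by (simp add: act_edge_split)
qed


lemma act_cell:
  assumes "c \<in> cell_boundaries \<Sigma> R" "is_path \<Sigma> R x c y" "is_word b S x"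
  shows "act c S = S"
proof -
  obtain p z q l1 r1 l2 r2 where c: "c = [(p, l1, r1, z @ l2 @ q), (p @ r1 @ z, l2, r2, q)] @
      path_inverse [(p @ l1 @ z, l2, r2, q), (p, l1, r1, z @ r2 @ q)]"
    and r: "(l1, r1) \<in> R" "(l2, r2) \<in> R"
    using assms(1) unfolding cell_boundaries_def mem_Collect_eq by (elim exE conjE) (rule that)
  have ne: "l1 \<noteq> []" "r1 \<noteq> []" "l2 \<noteq> []" "r2 \<noteq> []"
    using r pres unfolding semigroup_presentation_def by blast+
  have x: "x = p @ l1 @ z @ l2 @ q" using assms(2) unfolding c by simp
  obtain P A Z B Q where S: "S = P @ A @ Z @ B @ Q" and w: "is_word b P p" "is_word b A l1"
    "is_word b Z z" "is_word b B l2" "is_word b Q q"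
  proof -
    obtain P S1 where 1: "S = P @ S1" "is_word b P p" "is_word b S1 (l1 @ z @ l2 @ q)"
      using assms(3) unfolding x by (rule word_split)
    obtain A S2 where 2: "S1 = A @ S2" "is_word b A l1" "is_word b S2 (z @ l2 @ q)"
      using 1(3) by (rule word_split)
    obtain Z S3 where 3: "S2 = Z @ S3" "is_word b Z z" "is_word b S3 (l2 @ q)"
      using 2(3) by (rule word_split)
    obtain B Q where 4: "S3 = B @ Q" "is_word b B l2" "is_word b Q q"
      using 3(3) by (rule word_split)
    show ?thesis by (rule that) (use 1 2 3 4 in simp_all)
  qed
  have len: "length P = length p" "length A = length l1" "length Z = length z"
    "length B = length l2" "length Q = length q" 
    by (rule is_word_length, fact w)+
  have fl: "length (fire A r1) = length r1" "length (fire B r2) = length r2"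
    by (rule is_word_length, rule is_word_fire, rule w, rule ne)+
  have 1: "act_edge (p, l1, r1, z @ l2 @ q) S = P @ fire A r1 @ Z @ B @ Q"
    unfolding S using act_edge_split[of P p A l1 r1 _ "Z @ B @ Q"] len by simp
  have 2: "act_edge (p @ r1 @ z, l2, r2, q) (P @ fire A r1 @ Z @ B @ Q)
      = P @ fire A r1 @ Z @ fire B r2 @ Q"
    using act_edge_split[of "P @ fire A r1 @ Z" "p @ r1 @ z" B l2 r2 q Q] len fl by simp
  have 3: "act_edge (p, r1, l1, z @ r2 @ q) (P @ fire A r1 @ Z @ fire B r2 @ Q)
      = P @ A @ Z @ fire B r2 @ Q"
    using act_edge_split[of P p "fire A r1" r1 l1 _ "Z @ fire B r2 @ Q"] len fl
      is_word_fire_fire[OF w(2) ne(1,2)] by simp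
  have 4: "act_edge (p @ l1 @ z, r2, l2, q) (P @ A @ Z @ fire B r2 @ Q) = S"
    using act_edge_split[of "P @ A @ Z" "p @ l1 @ z" "fire B r2" r2 l2 q Q] len fl
      is_word_fire_fire[OF w(4) ne(3,4)] S by simp
  have "path_inverse [(p @ l1 @ z, l2, r2, q), (p, l1, r1, z @ r2 @ q)] =
      [(p, r1, l1, z @ r2 @ q), (p @ l1 @ z, r2, l2, q)]"
    by (simp add: path_inverse_def)
  then show ?thesis unfolding c by (simp only: append.simps fold_simps 1 2 3 4)
qed

text \<open>Both defining moves of homotopy act trivially: an inverse edge undoes the cell of the edge before
it, and around a 2-cell the two edges act on disjoint parts of the decorated word.\<close>
lemma act_homotopic:
  "homotopic \<Sigma> R x y \<gamma> \<delta> \<Longrightarrow> is_word b S x \<Longrightarrow> act \<gamma> S = act \<delta> S"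
proof (induction rule: homotopic.induct)
  case (backtrack \<gamma> e \<delta>)
  then obtain z where z: "is_path \<Sigma> R x \<gamma> z" "is_path \<Sigma> R z ([e, edge_inverse e] @ \<delta>) y"
    unfolding is_path_append[of _ _ _ \<gamma>] by blast
  have "is_word b (act \<gamma> S) z" using z(1) backtrack.prems by (rule is_word_act)
  then have "act_edge (edge_inverse e) (act_edge e (act \<gamma> S)) = act \<gamma> S"
    using z(2) by (intro act_backtrack) auto
  then show ?case by simp
next
  case (cell c \<gamma> \<delta>)
  then obtain z where z: "is_path \<Sigma> R x \<gamma> z" "is_path \<Sigma> R z (c @ \<delta>) y"
    unfolding is_path_append[of _ _ _ \<gamma>] by blast
  obtain z' where z': "is_path \<Sigma> R z c z'" using z(2) unfolding is_path_append by blast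
  have "is_word b (act \<gamma> S) z" using z(1) cell.prems by (rule is_word_act)
  then have "act c (act \<gamma> S) = act \<gamma> S" using act_cell[OF cell.hyps(1) z'] by simp
  then show ?case by simp
qed simp_all


section \<open>Creating paths\<close>

text \<open>A square remains a square when one of its two edge directions is reversed.  This supplies the
commutation of edges in all orientations, while 2-cells are attached for positive pairs only.\<close>
lemma homotopic_swap_inverse:
  assumes "homotopic \<Sigma> R x y [A, B] [C, D]"
  shows "homotopic \<Sigma> R (edge_target A) (edge_target C) [edge_inverse A, C] [B, edge_inverse D]"
proof -
  let ?x = "edge_target A" and ?y = "edge_target C"
  have p: "is_path \<Sigma> R x [A, B] y" "is_path \<Sigma> R x [C, D] y"
    using homotopic_is_path[OF assms] by auto
  have 1: "is_path \<Sigma> R ?x [edge_inverse A] x" "is_path \<Sigma> R y [edge_inverse D] ?y"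
    using p by (auto dest: is_path_start)
  have "is_path \<Sigma> R ?x ([edge_inverse A, C] @ [D, edge_inverse D] @ []) ?y"
    using p by (auto dest: is_path_start)
  from backtrack[OF this]
  have a: "homotopic \<Sigma> R ?x ?y ([edge_inverse A, C, D, edge_inverse D]) [edge_inverse A, C]" by simp
  have b: "homotopic \<Sigma> R ?x ?y [edge_inverse A, A, B, edge_inverse D] [edge_inverse A, C, D, edge_inverse D]"
    using homotopic_context[OF assms 1] by simp
  have "is_path \<Sigma> R ?x ([] @ [edge_inverse A, edge_inverse (edge_inverse A)] @ [B, edge_inverse D]) ?y"
    using p by (auto dest: is_path_start)
  from backtrack[OF this]
  have c: "homotopic \<Sigma> R ?x ?y [edge_inverse A, A, B, edge_inverse D] [B, edge_inverse D]" by simp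
  show ?thesis using a b c by (blast intro: homotopic.sym homotopic.trans)
qed

lemma commuting_edges_positive:
  assumes "(l1, r1) \<in> R" "(l2, r2) \<in> R" "p \<in> lists \<Sigma>" "z \<in> lists \<Sigma>" "q \<in> lists \<Sigma>"
  shows "homotopic \<Sigma> R (p @ l1 @ z @ l2 @ q) (p @ r1 @ z @ r2 @ q)
    [(p, l1, r1, z @ l2 @ q), (p @ r1 @ z, l2, r2, q)]
    [(p @ l1 @ z, l2, r2, q), (p, l1, r1, z @ r2 @ q)]"
proof -
  define A B C D where "A = (p, l1, r1, z @ l2 @ q)" and "B = (p @ r1 @ z, l2, r2, q)"
    and "C = (p @ l1 @ z, l2, r2, q)" and "D = (p, l1, r1, z @ r2 @ q)"
  note defs = A_def B_def C_def D_def
  let ?x = "p @ l1 @ z @ l2 @ q" and ?y = "p @ r1 @ z @ r2 @ q"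
  let ?c = "[A, B] @ path_inverse [C, D]"
  have c: "?c \<in> cell_boundaries \<Sigma> R"
    unfolding cell_boundaries_def mem_Collect_eq defs using assms by blast
  have w: "l1 \<in> lists \<Sigma>" "r1 \<in> lists \<Sigma>" "l2 \<in> lists \<Sigma>" "r2 \<in> lists \<Sigma>" "l1 \<noteq> []" "r1 \<noteq> []"
    using assms(1,2) pres unfolding semigroup_presentation_def by blast+
  have ed: "A \<in> edges \<Sigma> R" "B \<in> edges \<Sigma> R" "C \<in> edges \<Sigma> R" "D \<in> edges \<Sigma> R"
    unfolding defs edges_def using assms w by simp_all
  have 1: "is_path \<Sigma> R ?x [A, B] ?y" "is_path \<Sigma> R ?x [C, D] ?y"
    using ed assms w unfolding defs by simp_all
  then have p: "is_path \<Sigma> R ?x ([] @ ?c @ [C, D]) ?y"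
    using is_path_inverse unfolding is_path_append append_Nil by blast
  have a: "homotopic \<Sigma> R ?x ?y (?c @ [C, D]) [C, D]"
    using homotopic.cell[OF c p] by simp
  have "homotopic \<Sigma> R ?x ?y ([A, B] @ (path_inverse [C, D] @ [C, D]) @ []) ([A, B] @ [] @ [])"
    by (rule homotopic_context[OF homotopic_inverse_left[OF 1(2)] 1(1)]) (use assms w in simp)
  then have "homotopic \<Sigma> R ?x ?y (?c @ [C, D]) [A, B]" by simp
  then show ?thesis using a unfolding defs by (blast intro: homotopic.sym homotopic.trans)
qed

lemma commuting_edges:
  assumes "(l1, r1) \<in> R \<or> (r1, l1) \<in> R" "(l2, r2) \<in> R \<or> (r2, l2) \<in> R"
    and "p \<in> lists \<Sigma>" "z \<in> lists \<Sigma>" "q \<in> lists \<Sigma>"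
  shows "homotopic \<Sigma> R (p @ l1 @ z @ l2 @ q) (p @ r1 @ z @ r2 @ q)
    [(p, l1, r1, z @ l2 @ q), (p @ r1 @ z, l2, r2, q)]
    [(p @ l1 @ z, l2, r2, q), (p, l1, r1, z @ r2 @ q)]"
proof -
  note pos = commuting_edges_positive[OF _ _ assms(3-5)]
  have 1: "homotopic \<Sigma> R (p @ l @ z @ l2 @ q) (p @ r @ z @ r2 @ q)
      [(p, l, r, z @ l2 @ q), (p @ r @ z, l2, r2, q)]
      [(p @ l @ z, l2, r2, q), (p, l, r, z @ r2 @ q)]" if "(l, r) \<in> R" for l r
    using assms(2)
  proof
    assume "(r2, l2) \<in> R"
    from homotopic_swap_inverse[OF homotopic.sym[OF pos[OF that this]]]
    show ?thesis by (simp add: homotopic.sym)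
  qed (rule pos[OF that])
  from assms(1) show ?thesis
  proof
    assume "(r1, l1) \<in> R"
    from homotopic_swap_inverse[OF 1[OF this]] show ?thesis by simp
  qed (rule 1)
qed

end

lemma append_conv_right:
  assumes "P @ X @ Q = P' @ Y @ Q'" "length P' + length Y \<le> length P"
  obtains Z where "P = P' @ Y @ Z" "Q' = Z @ X @ Q"
proof -
  have "(P' @ Y) @ Q' = P @ (X @ Q)" using assms(1) by simp
  then consider us where "P' @ Y = P @ us" "us @ Q' = X @ Q" | us where "(P' @ Y) @ us = P" "Q' = us @ X @ Q"
    unfolding append_eq_append_conv2 by blast
  then show ?thesis
  proof cases
    case 1
    have "length (P' @ Y) = length P + length us" using 1(1) by simp
    then have "us = []" using assms(2) by simp
    then show ?thesis using 1 that[of "[]"] by simp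
  next
    case 2
    then show ?thesis using that[of us] by simp
  qed
qed

text \<open>Every letter of the bottom of a cell determines the cell and its own place in it.  Hence two
complete bottoms within one word are equal or disjoint.\<close>
lemma overlapping_outs:
  assumes "P @ outs A c @ Q = P' @ outs B u @ Q'"
    and "length P < length P' + length u" "length P' < length P + length c"
    and "c \<noteq> []" "u \<noteq> []"
  shows "P = P'" "A = B" "c = u" "Q = Q'"
proof -
  define t where "t = max (length P) (length P')"
  have t: "t - length P < length c" "length P \<le> t" "t - length P' < length u" "length P' \<le> t"
    using assms(2-5) unfolding t_def by (auto simp: max_def)
  have "(P @ outs A c @ Q) ! t = Out A c (t - length P)"
    using t(1,2) by (simp add: nth_append)
  moreover have "(P' @ outs B u @ Q') ! t = Out B u (t - length P')"
    using t(3,4) by (simp add: nth_append)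
  ultimately have e: "A = B" "c = u" "t - length P = t - length P'" using assms(1) by auto
  then have "length P = length P'" using t by linarith
  then show "P = P'" "A = B" "c = u" "Q = Q'" using assms(1) e by auto
qed

context presentation begin

lemma nullary_path: "is_path \<Sigma> R x \<gamma> y \<Longrightarrow> is_path \<Sigma> R x [] x \<and> is_path \<Sigma> R y [] y"
  using is_path_start is_path_end by fastforce

text \<open>If \<open>e\<close> removes a cell, compare it with the last edge \<open>f\<close> of the path.  Either \<open>f\<close> glued this very
cell and the two edges backtrack, or the cells are disjoint and \<open>e\<close> can be moved in front of \<open>f\<close>,
where the induction hypothesis applies.  The induction starts because an initial word has no cell
to remove.\<close>
lemma cancellation_shortens:
  assumes "is_path \<Sigma> R x \<gamma> y" "creating \<gamma> (start x)"
    and "e \<in> edges \<Sigma> R" "edge_source e = y" "cancels e (act \<gamma> (start x))"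
  shows "\<exists>\<gamma>'. homotopic \<Sigma> R x (edge_target e) (\<gamma> @ [e]) \<gamma>' \<and> creating \<gamma>' (start x) \<and> length \<gamma>' < length \<gamma>"
  using assms
proof (induction \<gamma> arbitrary: y e rule: rev_induct)
  case Nil
  have "is_word x (start x) (edge_source e)" using Nil is_word_start by simp
  with Nil(3) obtain p u v q P U Q where h: "e = (p, u, v, q)" "start x = P @ U @ Q" "is_word x P p" "is_word x U u"
    "is_word x Q q" "U \<noteq> []" "v \<noteq> []" "u \<noteq> v" "act_edge e (start x) = P @ fire U v @ Q"
    "cancels e (start x) \<longleftrightarrow> cancelable U v"
    by (rule edge_splitE)
  have "hd U \<in> set (start x)" using h(2,6) by (simp add: hd_in_set)
  then obtain i a where "hd U = Base i a" using start_letter by blast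
  then have False using not_cancelable_Base[OF h(6)] h(10) Nil(5) by simp
  then show ?case ..
next
  case (snoc f \<gamma>)
  define T where "T = act \<gamma> (start x)"
  obtain z where z: "is_path \<Sigma> R x \<gamma> z" "f \<in> edges \<Sigma> R" "edge_source f = z" "edge_target f = y"
    using snoc.prems(1) unfolding is_path_append by auto
  have cr: "creating \<gamma> (start x)" "\<not> cancels f T"
    using snoc.prems(2) unfolding creating_append T_def by simp_all
  have T: "is_word x T z" unfolding T_def using z(1) is_word_start by (rule is_word_act)
  have V: "is_word x (act_edge f T) (edge_source e)" "cancels e (act_edge f T)"
    using is_word_act_edge[of f x T] z T snoc.prems(4,5) unfolding T_def by simp_all
  have te: "is_path \<Sigma> R (edge_source e) [e] (edge_target e)"
    using is_path_end[OF snoc.prems(1)] is_path_end[OF snoc.prems(1)] snoc.prems(3,4)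
      edge_sides(2,4-7) by (cases e) auto
  have pfe: "is_path \<Sigma> R x (\<gamma> @ [f, e]) (edge_target e)"
    using snoc.prems(1) te snoc.prems(4) is_path_append[of \<Sigma> R x "\<gamma> @ [f]" "[e]" "edge_target e"]
    by auto
  \<comment> \<open>It suffices to exchange the last two edges, so that the cancelling one comes first.\<close>
  have step: ?case if sq: "homotopic \<Sigma> R z (edge_target e) [e1, f1] [f, e]"
    and e1: "cancels e1 T" "\<not> cancels f1 (act_edge e1 T)" for e1 f1
  proof -
    have p1: "is_path \<Sigma> R z [e1, f1] (edge_target e)" using homotopic_is_path[OF sq] by blast
    have "\<exists>\<gamma>'. homotopic \<Sigma> R x (edge_target e1) (\<gamma> @ [e1]) \<gamma>' \<and> creating \<gamma>' (start x) \<and> length \<gamma>' < length \<gamma>"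
      by (rule snoc.IH[OF z(1) cr(1)]) (use p1 e1(1) T_def in auto)
    then obtain \<gamma>' where g: "homotopic \<Sigma> R x (edge_target e1) (\<gamma> @ [e1]) \<gamma>'" "creating \<gamma>' (start x)"
      "length \<gamma>' < length \<gamma>" by blast
    have "act \<gamma>' (start x) = act_edge e1 T"
      using act_homotopic[OF g(1) is_word_start] by (simp add: T_def)
    then have c: "creating (\<gamma>' @ [f1]) (start x)" using g(2) e1(2) by (simp add: creating_append)
    have f1: "is_path \<Sigma> R (edge_target e1) [f1] (edge_target e)" using p1 by auto
    have nil: "is_path \<Sigma> R (edge_target e1) [] (edge_target e1)" "is_path \<Sigma> R (edge_target e) [] (edge_target e)"
      using nullary_path[OF f1] by auto
    have x: "is_path \<Sigma> R x [] x" using nullary_path[OF z(1)] by auto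
    have h1: "homotopic \<Sigma> R x (edge_target e) (\<gamma> @ [e1, f1]) (\<gamma> @ [f, e])"
      using homotopic_context[OF sq z(1) nil(2)] by simp
    have h2: "homotopic \<Sigma> R x (edge_target e) (\<gamma> @ [e1, f1]) (\<gamma>' @ [f1])"
      using homotopic_context[OF g(1) x f1] by simp
    have "homotopic \<Sigma> R x (edge_target e) ((\<gamma> @ [f]) @ [e]) (\<gamma>' @ [f1])"
      using h1 h2 by (simp, blast intro: homotopic.sym homotopic.trans)
    moreover have "length (\<gamma>' @ [f1]) < length (\<gamma> @ [f])" using g(3) by simp
    ultimately show ?case using c by blast
  qed
  have "is_word x T (edge_source f)" using T z(3) by simp
  with z(2) obtain p a c r P A Q where f: "f = (p, a, c, r)" "T = P @ A @ Q" "is_word x P p" "is_word x A a"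
    "is_word x Q r" "A \<noteq> []" "c \<noteq> []" "a \<noteq> c" "act_edge f T = P @ fire A c @ Q"
    "cancels f T \<longleftrightarrow> cancelable A c"
    by (rule edge_splitE)
  have nc: "\<not> cancelable A c" using f(10) cr(2) by simp
  have V': "act_edge f T = P @ outs A c @ Q" using f(9) nc by (simp add: fire_not_cancelable)
  obtain p' u v q' P' U Q' where e: "e = (p', u, v, q')" "act_edge f T = P' @ U @ Q'" "is_word x P' p'" "is_word x U u"
    "is_word x Q' q'" "U \<noteq> []" "v \<noteq> []" "u \<noteq> v" "act_edge e (act_edge f T) = P' @ fire U v @ Q'"
    "cancels e (act_edge f T) \<longleftrightarrow> cancelable U v"
    using snoc.prems(3) V(1) by (rule edge_splitE)
  have cU: "cancelable U v" using e(10) V(2) by simp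
  then obtain U' where "U = outs U' (lab U)" "lab U' = v" "fire U v = U'"
    using e(6) by (rule cancelableE)
  then have U': "U = outs U' u" "lab U' = v" "fire U v = U'" using e(4) by (auto simp: is_word_def)
  have labs: "lab P = p" "lab A = a" "lab Q = r" "lab P' = p'" "lab Q' = q'"
    using f(3-5) e(3,5) by (auto simp: is_word_def)
  have eq: "P @ outs A c @ Q = P' @ outs U' u @ Q'" using V' e(2) U'(1) by simp
  have R2: "(a, c) \<in> R \<or> (c, a) \<in> R" "(u, v) \<in> R \<or> (v, u) \<in> R"
    using z(2) snoc.prems(3) unfolding f(1) e(1) edges_def by auto
  have lists: "p \<in> lists \<Sigma>" "r \<in> lists \<Sigma>" "p' \<in> lists \<Sigma>" "q' \<in> lists \<Sigma>" 
    using edge_sides(6,7) z(2) snoc.prems(3) unfolding f(1) e(1) by blast+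
  have zeq: "z = p @ a @ r" using z(3) f(1) by simp
  consider (left) "length P' + length u \<le> length P" | (right) "length P + length c \<le> length P'"
    | (same) "length P < length P' + length u" "length P' < length P + length c" by linarith
  then show ?case
  proof cases
    case left
    obtain Z where Z: "P = P' @ outs U' u @ Z" "Q' = Z @ outs A c @ Q"
      using append_conv_right[OF eq] left by auto
    have p: "p = p' @ u @ lab Z" "q' = lab Z @ c @ r" using Z labs by auto
    have zl: "lab Z \<in> lists \<Sigma>" using lists(1) p(1) by simp
    define e1 f1 where "e1 = (p', u, v, lab Z @ a @ r)" and "f1 = (p' @ v @ lab Z, a, c, r)"
    have sq: "homotopic \<Sigma> R z (edge_target e) [e1, f1] [f, e]"
      using commuting_edges[OF R2(2,1) lists(3) zl lists(2)]
      unfolding e1_def f1_def zeq f(1) e(1) p by simp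
    have 1: "cancels e1 T \<longleftrightarrow> cancelable U v" "act_edge e1 T = P' @ U' @ Z @ A @ Q"
      unfolding f(2) Z(1) e1_def
      using cancels_split[of P' p' "outs U' u" u v _ "Z @ A @ Q"]
        act_edge_split[of P' p' "outs U' u" u v _ "Z @ A @ Q"] labs(4) U' by auto
    have 2: "cancels f1 (act_edge e1 T) \<longleftrightarrow> cancelable A c"
      unfolding 1(2) f1_def using cancels_split[of "P' @ U' @ Z" "p' @ v @ lab Z" A a c r Q] labs U'(2)
      by auto
    show ?thesis using step[OF sq] 1(1) 2 cU nc by blast
  next
    case right
    obtain Z where Z: "P' = P @ outs A c @ Z" "Q = Z @ outs U' u @ Q'"
      using append_conv_right[OF eq[symmetric]] right by auto
    have p: "p' = p @ c @ lab Z" "r = lab Z @ u @ q'" using Z labs by auto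
    have zl: "lab Z \<in> lists \<Sigma>" using lists(3) p(1) by simp
    define e1 f1 where "e1 = (p @ a @ lab Z, u, v, q')" and "f1 = (p, a, c, lab Z @ v @ q')"
    have sq: "homotopic \<Sigma> R z (edge_target e) [e1, f1] [f, e]"
      using homotopic.sym[OF commuting_edges[OF R2 lists(1) zl lists(4)]]
      unfolding e1_def f1_def zeq f(1) e(1) p by simp
    have 1: "cancels e1 T \<longleftrightarrow> cancelable U v" "act_edge e1 T = P @ A @ Z @ U' @ Q'"
      unfolding f(2) Z(2) e1_def
      using cancels_split[of "P @ A @ Z" "p @ a @ lab Z" "outs U' u" u v _ "Q'"]
        act_edge_split[of "P @ A @ Z" "p @ a @ lab Z" "outs U' u" u v _ "Q'"] labs U' by auto
    have 2: "cancels f1 (act_edge e1 T) \<longleftrightarrow> cancelable A c"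
      unfolding 1(2) f1_def using cancels_split[of P p A a c _ "Z @ U' @ Q'"] labs by auto
    show ?thesis using step[OF sq] 1(1) 2 cU nc by blast
  next
    case same
    have "u \<noteq> []" using e(6) U'(1) by auto
    from overlapping_outs[OF eq same f(7) this] have "e = edge_inverse f"
      using labs U'(2) unfolding e(1) f(1) by simp
    then have "homotopic \<Sigma> R x (edge_target e) ((\<gamma> @ [f]) @ [e]) \<gamma>"
      using homotopic.backtrack[of \<Sigma> R x \<gamma> f "[]" "edge_target e"] pfe by simp
    then show ?thesis using cr(1) by fastforce
  qed
qed

lemma creating_representative:
  assumes "is_path \<Sigma> R x \<gamma> y"
  shows "\<exists>\<gamma>'. homotopic \<Sigma> R x y \<gamma> \<gamma>' \<and> creating \<gamma>' (start x) \<and> length \<gamma>' \<le> length \<gamma> \<and>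
    (creating \<gamma> (start x) \<or> length \<gamma>' < length \<gamma>)"
  using assms
proof (induction \<gamma> arbitrary: y rule: rev_induct)
  case Nil
  then show ?case using homotopic.refl by fastforce
next
  case (snoc e \<gamma>)
  obtain z where z: "is_path \<Sigma> R x \<gamma> z" "is_path \<Sigma> R z [e] y"
    using snoc.prems unfolding is_path_append by auto
  from snoc.IH[OF z(1)] obtain \<gamma>' where g: "homotopic \<Sigma> R x z \<gamma> \<gamma>'" "creating \<gamma>' (start x)"
    "length \<gamma>' \<le> length \<gamma>" "creating \<gamma> (start x) \<or> length \<gamma>' < length \<gamma>" by blast
  have p: "is_path \<Sigma> R x \<gamma>' z" using homotopic_is_path[OF g(1)] by blast
  have a: "act \<gamma>' (start x) = act \<gamma> (start x)" using act_homotopic[OF g(1) is_word_start] by simp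
  have h: "homotopic \<Sigma> R x y (\<gamma> @ [e]) (\<gamma>' @ [e])"
    by (rule homotopic_append[OF g(1)]) (rule homotopic.refl[OF z(2)])
  show ?case
  proof (cases "cancels e (act \<gamma> (start x))")
    case False
    then have "creating (\<gamma>' @ [e]) (start x)" using g(2) a by (simp add: creating_append)
    moreover have "creating (\<gamma> @ [e]) (start x) \<or> length (\<gamma>' @ [e]) < length (\<gamma> @ [e])"
      using g(4) False by (auto simp: creating_append)
    ultimately show ?thesis using h g(3) by (intro exI[of _ "\<gamma>' @ [e]"]) simp
  next
    case True
    have "\<exists>\<gamma>''. homotopic \<Sigma> R x (edge_target e) (\<gamma>' @ [e]) \<gamma>'' \<and> creating \<gamma>'' (start x) \<and> length \<gamma>'' < length \<gamma>'"
      by (rule cancellation_shortens[OF p g(2)]) (use z(2) a True in auto)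
    moreover have "edge_target e = y" using z(2) by simp
    ultimately obtain \<gamma>'' where "homotopic \<Sigma> R x y (\<gamma>' @ [e]) \<gamma>''" "creating \<gamma>'' (start x)"
      "length \<gamma>'' < length \<gamma>'" by blast
    then show ?thesis using homotopic.trans[OF h] g(3)
      by (intro exI[of _ \<gamma>'']) simp
  qed
qed

end

section \<open>Counting cells\<close>

text \<open>A cell is charged to the leftmost letter of its bottom only, so that the weights in a decorated
word add up to the number of all cells in its history.\<close>
primrec weight :: "'a letter \<Rightarrow> nat" where
  "weight (Base i a) = 0"
| "weight (Out U v i) = (if i = 0 then Suc (sum_list (map weight U)) else 0)"

abbreviation cells :: "'a letter list \<Rightarrow> nat" where
  "cells S \<equiv> sum_list (map weight S)"

lemma cells_outs: "v \<noteq> [] \<Longrightarrow> cells (outs U v) = Suc (cells U)"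
proof -
  assume "v \<noteq> []"
  then have "[0..<length v] = 0 # [1..<length v]" by (simp add: upt_conv_Cons)
  moreover have "map (weight \<circ> Out U v) [1..<length v] = map (\<lambda>_. 0) [1..<length v]"
    by (rule map_cong) auto
  ultimately show ?thesis by (simp add: outs_def)
qed

lemma cells_start [simp]: "cells (start x) = 0"
  by (induction x) auto

context presentation begin

lemma cells_act_edge:
  assumes "e \<in> edges \<Sigma> R" "is_word b S (edge_source e)"
  shows "cells (act_edge e S) \<le> Suc (cells S)"
    and "\<not> cancels e S \<Longrightarrow> cells (act_edge e S) = Suc (cells S)"
proof -
  obtain p u v q P U Q where h: "S = P @ U @ Q" "U \<noteq> []" "v \<noteq> []" "act_edge e S = P @ fire U v @ Q"
    "cancels e S \<longleftrightarrow> cancelable U v"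
    by (rule edge_splitE[OF assms]) (rule that)
  show 1: "cells (act_edge e S) = Suc (cells S)" if "\<not> cancels e S"
    using that h by (simp add: fire_not_cancelable cells_outs)
  show "cells (act_edge e S) \<le> Suc (cells S)"
  proof (cases "cancels e S")
    case True
    then have "cancelable U v" using h by simp
    then obtain U' where U': "U = outs U' (lab U)" "fire U v = U'"
      using h(2) by (rule cancelableE)
    have "cells U = Suc (cells U')" using U'(1) h(2) cells_outs by (metis map_is_Nil_conv)
    then show ?thesis using h(1,4) U'(2) by simp
  qed (simp add: 1)
qed

lemma cells_act_le:
  "is_path \<Sigma> R x \<gamma> y \<Longrightarrow> is_word b S x \<Longrightarrow> cells (act \<gamma> S) \<le> cells S + length \<gamma>"
proof (induction \<gamma> arbitrary: x S)
  case (Cons e \<gamma>)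
  then have e: "e \<in> edges \<Sigma> R" "is_word b S (edge_source e)" "is_path \<Sigma> R (edge_target e) \<gamma> y" by auto
  show ?case
    using Cons.IH[OF e(3) is_word_act_edge[OF e(1,2)]] cells_act_edge(1)[OF e(1,2)] by simp
qed simp

lemma cells_act_creating:
  "is_path \<Sigma> R x \<gamma> y \<Longrightarrow> is_word b S x \<Longrightarrow> creating \<gamma> S \<Longrightarrow> cells (act \<gamma> S) = cells S + length \<gamma>"
proof (induction \<gamma> arbitrary: x S)
  case (Cons e \<gamma>)
  then have e: "e \<in> edges \<Sigma> R" "is_word b S (edge_source e)" "is_path \<Sigma> R (edge_target e) \<gamma> y"
    "\<not> cancels e S" "creating \<gamma> (act_edge e S)" by auto
  show ?case
    using Cons.IH[OF e(3) is_word_act_edge[OF e(1,2)] e(5)] cells_act_edge(2)[OF e(1,2,4)] by simp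
qed simp

end

section \<open>Substitution\<close>

text \<open>Left multiplication by a path that leads to the decorated word \<open>S\<close>: the initial letters are
replaced by those of \<open>S\<close> and the cells below them are fired again, which may remove cells of \<open>S\<close>.\<close>
primrec subst :: "'a letter list \<Rightarrow> 'a letter \<Rightarrow> 'a letter" where
  "subst S (Base i a) = rev S ! i"
| "subst S (Out U v i) = fire (map (subst S) U) v ! i"

lemma map_subst_start: "length S = length x \<Longrightarrow> map (subst S) (start x) = S"
proof -
  have "map (subst (S0 @ S)) (start x) = S" if "length S = length x" for S0 S
    using that
  proof (induction x arbitrary: S0 S)
    case (Cons a x)
    then obtain s S' where S: "S = s # S'" "length S' = length x" by (cases S) auto
    show ?case using Cons.IH[OF S(2), of "S0 @ [s]"] S by (simp add: nth_append)
  qed simp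
  from this[of S "[]"] show "length S = length x \<Longrightarrow> ?thesis" by simp
qed

lemma reduced_subst:
  assumes "is_word b S x" "reduced x L"
  shows "reduced b (subst S L) \<and> label (subst S L) = label L"
  using assms(2)
proof (induction L)
  case (Base i a)
  then have a: "Base i a \<in> set (start x)" by simp
  then have i: "i < length (rev S)" using start_letter assms(1) by (fastforce simp: is_word_def)
  then have "rev S ! i \<in> set S" by (metis nth_mem set_rev)
  moreover have "label (rev S ! i) = rev x ! i"
    using assms(1) i nth_map[OF i, of label] by (auto simp: is_word_def rev_map)
  ultimately show ?case using assms(1) nth_rev_start[OF a] by (simp add: is_word_def)
next
  case (Out U v i)
  have U: "\<forall>L\<in>set (map (subst S) U). reduced b L" "map (subst S) U \<noteq> []" "i < length v"
    using Out by auto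
  have "length (fire (map (subst S) U) v) = length v" using U(2) by (rule length_fire)
  then have "fire (map (subst S) U) v ! i \<in> set (fire (map (subst S) U) v)"
    "label (fire (map (subst S) U) v ! i) = lab (fire (map (subst S) U) v) ! i"
    using U(3) by auto
  then show ?case using reduced_fire[OF U(1,2)] lab_fire[OF U(2)] by simp
qed

lemma is_word_subst:
  assumes "is_word b S x" "is_word x T t" shows "is_word b (map (subst S) T) t"
proof -
  have "map (label \<circ> subst S) T = lab T"
    using assms(2) reduced_subst[OF assms(1)] by (intro map_cong) (auto simp: is_word_def)
  then show ?thesis using assms(2) reduced_subst[OF assms(1)] by (auto simp: is_word_def)
qed

lemma map_subst_outs:
  assumes "U \<noteq> []" shows "map (subst S) (outs U v) = fire (map (subst S) U) v"
  using assms by (intro nth_equalityI) (simp_all add: length_fire)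

lemma map_subst_fire:
  assumes "is_word b S x" "is_word x U u" "U \<noteq> []" "v \<noteq> []"
  shows "map (subst S) (fire U v) = fire (map (subst S) U) v"
proof (cases "cancelable U v")
  case False
  then show ?thesis using assms(3) by (simp add: fire_not_cancelable map_subst_outs)
next
  case True
  then obtain U' where U': "U = outs U' (lab U)" "lab U' = v" "fire U v = U'"
    using assms(3) by (rule cancelableE)
  have u: "lab U = u" using assms(2) by (simp add: is_word_def)
  have "u \<noteq> []" using assms(3) u by auto
  have r: "reduced x (Out U' u 0)"
    using assms(2,3) U'(1) u unfolding is_word_def by (metis \<open>u \<noteq> []\<close> hd_in_set hd_outs)
  then have "is_word x U' v" "U' \<noteq> []" using U'(2) by (auto simp: is_word_def)
  then have w: "is_word b (map (subst S) U') v" using is_word_subst[OF assms(1)] by blast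
  have "map (subst S) U = fire (map (subst S) U') u"
    using U'(1) u map_subst_outs[OF \<open>U' \<noteq> []\<close>] by metis
  then show ?thesis using is_word_fire_fire[OF w assms(4) \<open>u \<noteq> []\<close>] U'(3) by simp
qed

context presentation begin

lemma map_subst_act:
  assumes "is_word b S x" "is_path \<Sigma> R y \<gamma> z" "is_word x T y"
  shows "map (subst S) (act \<gamma> T) = act \<gamma> (map (subst S) T)"
  using assms(2,3)
proof (induction \<gamma> arbitrary: y T)
  case (Cons e \<gamma>)
  then have e: "e \<in> edges \<Sigma> R" "is_word x T (edge_source e)" "is_path \<Sigma> R (edge_target e) \<gamma> z" by auto
  from e(1,2) obtain p u v q P U Q where h: "e = (p, u, v, q)" "T = P @ U @ Q" "is_word x P p" "is_word x U u"
    "is_word x Q q" "U \<noteq> []" "v \<noteq> []" "u \<noteq> v" "act_edge e T = P @ fire U v @ Q"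
    "cancels e T \<longleftrightarrow> cancelable U v"
    by (rule edge_splitE)
  have l: "length P = length p" "length U = length u" using h(3,4) by (auto simp: is_word_def)
  have "act_edge e (map (subst S) T) = map (subst S) (act_edge e T)"
    unfolding h(9) unfolding h(1,2)
    using act_edge_split[of "map (subst S) P" p "map (subst S) U" u v q "map (subst S) Q"] l
      map_subst_fire[OF assms(1) h(4,6,7)] by simp
  then show ?case using Cons.IH[OF e(3) is_word_act_edge[OF e(1,2)]] by simp
qed simp

lemma act_eq_map_subst:
  assumes "is_word b S x" "is_path \<Sigma> R x \<gamma> y"
  shows "act \<gamma> S = map (subst S) (act \<gamma> (start x))"
proof -
  have "length S = length x" using assms(1) by (auto simp: is_word_def)
  then show ?thesis using map_subst_act[OF assms is_word_start] map_subst_start by metis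
qed

text \<open>Left multiplication by the inverse path inverts the substitution: on initial letters because the
path followed back leads to the initial word, and on all others because substitutions commute with
firing.\<close>
lemma subst_inverse:
  assumes "is_path \<Sigma> R y \<gamma> x" "reduced x L"
  shows "subst (act (path_inverse \<gamma>) (start x)) (subst (act \<gamma> (start y)) L) = L"
proof -
  define S S' where "S = act \<gamma> (start y)" and "S' = act (path_inverse \<gamma>) (start x)"
  have S: "is_word y S x" unfolding S_def using assms(1) is_word_start by (rule is_word_act)
  have S': "is_word x S' y"
    unfolding S'_def using is_path_inverse[OF assms(1)] is_word_start by (rule is_word_act)
  have "map (subst S') S = act \<gamma> S'"
    unfolding S_def using act_eq_map_subst[OF S' assms(1)] by simp
  also have "\<dots> = act (path_inverse \<gamma> @ \<gamma>) (start x)" by (simp add: S'_def)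
  also have "\<dots> = start x"
    using act_homotopic[OF homotopic_inverse_left[OF assms(1)] is_word_start] by simp
  finally have inv: "map (subst S') S = start x" .
  have "reduced x L \<Longrightarrow> subst S' (subst S L) = L" for L
  proof (induction L)
    case (Base i a)
    then have a: "Base i a \<in> set (start x)" by simp
    then have i: "i < length (rev S)" using start_letter S by (fastforce simp: is_word_def)
    have "subst S' (rev S ! i) = rev (map (subst S') S) ! i" using i by (simp add: rev_map)
    then show ?case using inv nth_rev_start[OF a] by simp
  next
    case (Out U v i)
    have U: "is_word x U (lab U)" "U \<noteq> []" "v \<noteq> []" "i < length v" "\<not> cancelable U v"
      using Out.prems by (auto simp: is_word_def)
    have m: "map (subst S) U \<noteq> []" using U(2) by simp
    have w: "is_word y (map (subst S) U) (lab U)" using S U(1) by (rule is_word_subst)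
    have eq: "map (subst S') (map (subst S) U) = U" using Out by (simp add: map_idI)
    have "subst S' (fire (map (subst S) U) v ! i) = map (subst S') (fire (map (subst S) U) v) ! i"
      using U(4) length_fire[OF m, of v] by simp
    also have "\<dots> = fire U v ! i" using map_subst_fire[OF S' w m U(3)] eq by simp
    finally show ?case using U by (simp add: fire_not_cancelable)
  qed
  then show ?thesis using assms(2) unfolding S_def S'_def by blast
qed

lemma map_subst_inject:
  assumes "is_path \<Sigma> R y \<gamma> x" "is_word x T t" "is_word x T' t'"
    and "map (subst (act \<gamma> (start y))) T = map (subst (act \<gamma> (start y))) T'"
  shows "T = T'"
proof -
  let ?i = "subst (act (path_inverse \<gamma>) (start x))"
  have "map ?i (map (subst (act \<gamma> (start y))) A) = A" if "is_word x A a" for A a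
    using that subst_inverse[OF assms(1)] by (simp add: is_word_def map_idI)
  then show ?thesis using assms(2-4) by metis
qed

text \<open>Consider the cell that produced the first letter of \<open>U\<close>.  If left translation does not undo it,
then a translate of \<open>U\<close> that forms the complete bottom of a cell forms that of the translate of this
very cell.  By injectivity, \<open>U\<close> was its complete bottom before the translation already.  So
translation cannot create cancellations between cells that survive it.\<close>
lemma cancelable_lift:
  assumes "is_path \<Sigma> R y \<gamma> x" "is_word x U u" "U \<noteq> []" "hd U = Out X t i"
    and "\<not> cancelable (map (subst (act \<gamma> (start y))) X) t"
    and "cancelable (map (subst (act \<gamma> (start y))) U) v"
  shows "cancelable U v"
proof -
  let ?s = "subst (act \<gamma> (start y))"
  have S: "is_word y (act \<gamma> (start y)) x" using assms(1) is_word_start by (rule is_word_act)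
  have u: "lab U = u" "u \<noteq> []" using assms(2,3) by (auto simp: is_word_def)
  have h: "reduced x (Out X t i)" using assms(2-4) unfolding is_word_def by (metis hd_in_set)
  then have X: "is_word x X (lab X)" "X \<noteq> []" "i < length t" "\<not> cancelable X t" by (auto simp: is_word_def)
  have lu: "lab (map ?s U) = u" using is_word_subst[OF S assms(2)] by (simp add: is_word_def)
  have lX: "lab (map ?s X) = lab X" using is_word_subst[OF S X(1)] by (simp add: is_word_def)
  obtain U' where U': "map ?s U = outs U' u" "lab U' = v"
    using assms(6) lu unfolding cancelable_def by metis
  have "hd (map ?s U) = Out (map ?s X) t i"
    using assms(3,4,5) X(3) by (simp add: hd_map fire_not_cancelable)
  then have eq: "U' = map ?s X" "t = u" using U'(1) u(2) by auto
  have "map ?s (outs X t) = outs (map ?s X) t"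
    using map_subst_outs[OF X(2)] assms(5) by (simp add: fire_not_cancelable)
  then have "map ?s U = map ?s (outs X t)" using U'(1) eq by simp
  moreover have "is_word x (outs X t) t"
    using X by (auto simp: is_word_def set_outs)
  ultimately have "U = outs X t" using map_subst_inject[OF assms(1,2)] by blast
  then show ?thesis using u(2) eq U'(2) lX by auto
qed

end

section \<open>Linear growth of powers\<close>

definition path_power :: "'a edge list \<Rightarrow> nat \<Rightarrow> 'a edge list" where
  "path_power \<gamma> n = concat (replicate n \<gamma>)"

lemma path_power_simps [simp]:
  "path_power \<gamma> 0 = []" "path_power \<gamma> (Suc n) = \<gamma> @ path_power \<gamma> n"
  by (simp_all add: path_power_def)

lemma path_power_Suc_right: "path_power \<gamma> (Suc n) = path_power \<gamma> n @ \<gamma>"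
  by (induction n) auto

lemma path_power_rotate: "path_power (\<beta> @ \<alpha>) (Suc n) = \<beta> @ path_power (\<alpha> @ \<beta>) n @ \<alpha>"
  by (induction n) auto

lemma map_path_power: "map f (path_power \<gamma> n) = path_power (map f \<gamma>) n"
  by (induction n) auto

fun shift :: "'a \<Rightarrow> 'a edge \<Rightarrow> 'a edge" where
  "shift a (p, u, v, q) = (a # p, u, v, q)"

lemma shift_simps [simp]:
  "edge_source (shift a e) = a # edge_source e" "edge_target (shift a e) = a # edge_target e"
  "edge_inverse (shift a e) = shift a (edge_inverse e)"
  by (cases e; simp)+

lemma act_shift: "act (map (shift a) \<gamma>) (L # S) = L # act \<gamma> S"
proof (induction \<gamma> arbitrary: S)
  case (Cons e \<gamma>)
  have "act_edge (shift a e) (L # S) = L # act_edge e S" by (cases e) (simp add: act_edge.simps)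
  then show ?case using Cons by simp
qed simp

context presentation begin

text \<open>The length of a homotopy class is bounded below through all its representatives, up to a constant.
The constant makes the property invariant under conjugation.\<close>
definition linear_growth :: "'a list \<Rightarrow> 'a edge list \<Rightarrow> bool" where
  "linear_growth w \<gamma> \<longleftrightarrow>
     (\<exists>c. \<forall>n \<delta>. homotopic \<Sigma> R w w (path_power \<gamma> n) \<delta> \<longrightarrow> n \<le> length \<delta> + c)"

lemma is_path_power: "is_path \<Sigma> R w \<gamma> w \<Longrightarrow> is_path \<Sigma> R w (path_power \<gamma> n) w"
  using nullary_path by (induction n) (auto simp: is_path_append)

lemma homotopic_power:
  assumes "homotopic \<Sigma> R w w \<gamma> \<delta>"
  shows "homotopic \<Sigma> R w w (path_power \<gamma> n) (path_power \<delta> n)"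
proof (induction n)
  case 0
  then show ?case using homotopic_is_path[OF assms] nullary_path by (auto intro: homotopic.refl)
next
  case (Suc n)
  then show ?case using homotopic_append[OF assms] by simp
qed

lemma linear_growth_homotopic:
  assumes "homotopic \<Sigma> R w w \<gamma> \<delta>" "linear_growth w \<delta>"
  shows "linear_growth w \<gamma>"
  using assms(2) homotopic_power[OF assms(1)] unfolding linear_growth_def
  by (blast intro: homotopic.sym homotopic.trans)

lemma linear_growth_rotate:
  assumes "is_path \<Sigma> R x \<alpha> y" "is_path \<Sigma> R y \<beta> x" "linear_growth y (\<beta> @ \<alpha>)"
  shows "linear_growth x (\<alpha> @ \<beta>)"
proof -
  obtain c where c: "\<And>n \<delta>. homotopic \<Sigma> R y y (path_power (\<beta> @ \<alpha>) n) \<delta> \<Longrightarrow> n \<le> length \<delta> + c"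
    using assms(3) unfolding linear_growth_def by blast
  have "n \<le> length \<delta> + (length \<alpha> + length \<beta> + c)"
    if "homotopic \<Sigma> R x x (path_power (\<alpha> @ \<beta>) n) \<delta>" for n \<delta>
    using c[of "Suc n" "\<beta> @ \<delta> @ \<alpha>"] homotopic_context[OF that assms(2,1)]
    unfolding path_power_rotate by simp
  then show ?thesis unfolding linear_growth_def by blast
qed

lemma homotopic_inverse_right:
  assumes "is_path \<Sigma> R x \<gamma> y"
  shows "homotopic \<Sigma> R x x (\<gamma> @ path_inverse \<gamma>) []"
proof -
  have "path_inverse (path_inverse \<gamma>) = \<gamma>" by (simp add: path_inverse_def rev_map map_idI)
  then show ?thesis using homotopic_inverse_left[OF is_path_inverse[OF assms]] by simp
qed

lemma null_homotopic_rotate: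
  assumes "is_path \<Sigma> R x \<alpha> y" "is_path \<Sigma> R y \<beta> x" "homotopic \<Sigma> R y y (\<beta> @ \<alpha>) []"
  shows "homotopic \<Sigma> R x x (\<alpha> @ \<beta>) []"
proof -
  let ?i = "path_inverse \<alpha>"
  have i: "is_path \<Sigma> R y ?i x" using assms(1) by (rule is_path_inverse)
  have p: "is_path \<Sigma> R x (\<alpha> @ \<beta>) x" using assms(1,2) is_path_append by blast
  have nil: "is_path \<Sigma> R x [] x" using nullary_path[OF p] by blast
  have 1: "homotopic \<Sigma> R x x ((\<alpha> @ \<beta>) @ (\<alpha> @ ?i) @ []) ((\<alpha> @ \<beta>) @ [] @ [])"
    using homotopic_inverse_right[OF assms(1)] p nil by (rule homotopic_context)
  have 2: "homotopic \<Sigma> R x x (\<alpha> @ (\<beta> @ \<alpha>) @ ?i) (\<alpha> @ [] @ ?i)"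
    using assms(3,1) i by (rule homotopic_context)
  show ?thesis using 1 2 homotopic_inverse_right[OF assms(1)]
    by (simp, blast intro: homotopic.sym homotopic.trans)
qed

subsection \<open>Removing a fixed first letter\<close>

lemma shift_edge: "e \<in> edges \<Sigma> R \<Longrightarrow> a \<in> \<Sigma> \<Longrightarrow> shift a e \<in> edges \<Sigma> R"
  unfolding edges_def by auto

lemma is_path_shift:
  "is_path \<Sigma> R x \<gamma> y \<Longrightarrow> a \<in> \<Sigma> \<Longrightarrow> is_path \<Sigma> R (a # x) (map (shift a) \<gamma>) (a # y)"
  by (induction \<gamma> arbitrary: x) (auto simp: shift_edge)

lemma shift_cell:
  assumes "c \<in> cell_boundaries \<Sigma> R" "a \<in> \<Sigma>" shows "map (shift a) c \<in> cell_boundaries \<Sigma> R"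
proof -
  obtain p z q l1 r1 l2 r2 where c: "c = [(p, l1, r1, z @ l2 @ q), (p @ r1 @ z, l2, r2, q)] @
      path_inverse [(p @ l1 @ z, l2, r2, q), (p, l1, r1, z @ r2 @ q)]"
    and r: "p \<in> lists \<Sigma>" "z \<in> lists \<Sigma>" "q \<in> lists \<Sigma>" "(l1, r1) \<in> R" "(l2, r2) \<in> R"
    using assms(1) unfolding cell_boundaries_def mem_Collect_eq by (elim exE conjE) (rule that)
  have "map (shift a) c = [(a # p, l1, r1, z @ l2 @ q), ((a # p) @ r1 @ z, l2, r2, q)] @
      path_inverse [((a # p) @ l1 @ z, l2, r2, q), (a # p, l1, r1, z @ r2 @ q)]"
    unfolding c by (simp add: path_inverse_def)
  moreover have "a # p \<in> lists \<Sigma>" using r(1) assms(2) by simp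
  ultimately show ?thesis unfolding cell_boundaries_def mem_Collect_eq using r(2-5) by blast
qed

lemma homotopic_shift:
  "homotopic \<Sigma> R x y \<gamma> \<delta> \<Longrightarrow> a \<in> \<Sigma> \<Longrightarrow>
    homotopic \<Sigma> R (a # x) (a # y) (map (shift a) \<gamma>) (map (shift a) \<delta>)"
proof (induction rule: homotopic.induct)
  case (refl \<gamma>)
  then show ?case by (intro homotopic.refl is_path_shift)
next
  case (sym \<gamma> \<delta>)
  then show ?case by (blast intro: homotopic.sym)
next
  case (trans \<gamma> \<delta> \<epsilon>)
  then show ?case by (blast intro: homotopic.trans)
next
  case (backtrack \<gamma> e \<delta>)
  have "is_path \<Sigma> R (a # x) (map (shift a) \<gamma> @ [shift a e, edge_inverse (shift a e)] @ map (shift a) \<delta>) (a # y)"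
    using is_path_shift[OF backtrack] by simp
  from homotopic.backtrack[OF this] show ?case by simp
next
  case (cell c \<gamma> \<delta>)
  have "is_path \<Sigma> R (a # x) (map (shift a) \<gamma> @ map (shift a) c @ map (shift a) \<delta>) (a # y)"
    using is_path_shift[OF cell(2,3)] by simp
  from homotopic.cell[OF shift_cell[OF cell(1,3)] this] show ?case by simp
qed

text \<open>The nonempty word \<open>x\<close> matters for the empty path: words of the Squier complex are nonempty.\<close>
lemma path_without_left_edges:
  assumes "is_path \<Sigma> R (a # x) \<gamma> y" "x \<noteq> []" "\<And>e. e \<in> set \<gamma> \<Longrightarrow> fst e \<noteq> []"
  shows "\<exists>\<gamma>' y'. \<gamma> = map (shift a) \<gamma>' \<and> y = a # y' \<and> is_path \<Sigma> R x \<gamma>' y'"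
  using assms
proof (induction \<gamma> arbitrary: x)
  case Nil
  then show ?case by simp
next
  case (Cons e \<gamma>)
  obtain p u v q where e: "e = (p, u, v, q)" by (metis prod.exhaust)
  have ed: "e \<in> edges \<Sigma> R" "p @ u @ q = a # x" "is_path \<Sigma> R (p @ v @ q) \<gamma> y" "a # x \<in> lists \<Sigma>"
    using Cons.prems(1) e by auto
  obtain p' where p: "p = a # p'" using Cons.prems(3)[of e] ed(2) e by (cases p) auto
  have x: "x = p' @ u @ q" using ed(2) p by simp
  have e': "(p', u, v, q) \<in> edges \<Sigma> R" using ed(1) e p unfolding edges_def by auto
  have "p' @ v @ q \<noteq> []" using edge_sides(2)[OF e'] by simp
  then obtain \<gamma>' y' where "\<gamma> = map (shift a) \<gamma>'" "y = a # y'" "is_path \<Sigma> R (p' @ v @ q) \<gamma>' y'"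
    using Cons.IH[of "p' @ v @ q"] ed(3) Cons.prems(3) p by auto
  then have "e # \<gamma> = map (shift a) ((p', u, v, q) # \<gamma>') \<and> y = a # y' \<and> is_path \<Sigma> R x ((p', u, v, q) # \<gamma>') y'"
    using e p e' x ed(4) Cons.prems(2) by simp
  then show ?case by (intro exI[where x = "(p', u, v, q) # \<gamma>'"] exI[where x = y'])
qed

text \<open>A short representative after the shift may well use the first letter.  It nevertheless yields a
bound for the original powers, because both paths produce decorated words with equally many cells.\<close>
lemma linear_growth_shift:
  assumes "is_path \<Sigma> R x \<gamma> x" "linear_growth x \<gamma>"
  shows "linear_growth (a # x) (map (shift a) \<gamma>)"
proof -
  obtain c where c: "\<And>n \<delta>. homotopic \<Sigma> R x x (path_power \<gamma> n) \<delta> \<Longrightarrow> n \<le> length \<delta> + c"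
    using assms(2) unfolding linear_growth_def by blast
  have "n \<le> length \<delta> + c" if h: "homotopic \<Sigma> R (a # x) (a # x) (path_power (map (shift a) \<gamma>) n) \<delta>" for n \<delta>
  proof -
    obtain \<epsilon> where e: "homotopic \<Sigma> R x x (path_power \<gamma> n) \<epsilon>" "creating \<epsilon> (start x)"
      using creating_representative[OF is_path_power[OF assms(1)]] by blast
    have "is_path \<Sigma> R x \<epsilon> x" using homotopic_is_path[OF e(1)] by blast
    then have "length \<epsilon> = cells (act \<epsilon> (start x))"
      using cells_act_creating[OF _ is_word_start e(2)] by simp
    also have "\<dots> = cells (act (path_power \<gamma> n) (start x))"
      using act_homotopic[OF e(1) is_word_start] by simp
    also have "\<dots> = cells (act (path_power (map (shift a) \<gamma>) n) (start (a # x)))"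
      by (simp add: act_shift flip: map_path_power)
    also have "\<dots> = cells (act \<delta> (start (a # x)))"
      using act_homotopic[OF h is_word_start] by (simp del: start.simps)
    also have "\<dots> \<le> length \<delta>"
      using cells_act_le[OF _ is_word_start] homotopic_is_path[OF h] by fastforce
    finally show ?thesis using c[OF e(1)] by linarith
  qed
  then show ?thesis unfolding linear_growth_def by blast
qed

subsection \<open>Growth at the first letter\<close>

end

text \<open>The last cell above the letter is undone by left multiplication with the path to \<open>S\<close>.\<close>
definition folds :: "'a letter list \<Rightarrow> 'a letter \<Rightarrow> bool" where
  "folds S L \<longleftrightarrow> (\<exists>X t i. L = Out X t i \<and> cancelable (map (subst S) X) t)"

lemma folds_simps [simp]:
  "\<not> folds S (Base i a)" "folds S (Out X t i) \<longleftrightarrow> cancelable (map (subst S) X) t"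
  by (simp_all add: folds_def)

text \<open>The first letters whose chain of leftmost ancestors begins with the cell \<open>U0 \<rightarrow> v\<close>.  In the tree
of first letters, these form the branch behind the edge given by this cell.\<close>
inductive stem :: "'a letter list \<Rightarrow> 'a list \<Rightarrow> 'a letter \<Rightarrow> bool" for U0 v where
  first: "stem U0 v (Out U0 v 0)"
| higher: "stem U0 v (hd U) \<Longrightarrow> stem U0 v (Out U t 0)"

lemma stem_Out: "stem U0 v L \<Longrightarrow> \<exists>U t. L = Out U t 0"
  by (cases rule: stem.cases) auto

context presentation begin

text \<open>A path that glues cells both to \<open>T\<close> and to its translate glues corresponding cells, and none of
them is undone by the translation.\<close>
lemma creating_no_folds:
  assumes "is_path \<Sigma> R y \<gamma> z" "is_word x T y" "creating \<gamma> T" "creating \<gamma> (map (subst S) T)"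
    and "is_word b S x" "\<And>L. L \<in> set T \<Longrightarrow> \<not> folds S L" "L \<in> set (act \<gamma> T)"
  shows "\<not> folds S L"
  using assms(1-4,6,7)
proof (induction \<gamma> arbitrary: y T)
  case (Cons e \<gamma>)
  then have e: "e \<in> edges \<Sigma> R" "is_word x T (edge_source e)" "is_path \<Sigma> R (edge_target e) \<gamma> z"
     "\<not> cancels e T" "\<not> cancels e (map (subst S) T)" "is_path \<Sigma> R y [e] (edge_target e)"
    using nullary_path[of "edge_target e" \<gamma> z] by auto
  have m: "map (subst S) (act_edge e T) = act_edge e (map (subst S) T)"
    using map_subst_act[OF assms(5) e(6)] Cons.prems(2) by simp
  from e(1,2) obtain p u v q P U Q where h: "e = (p, u, v, q)" "T = P @ U @ Q" "is_word x P p" "is_word x U u"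
    "is_word x Q q" "U \<noteq> []" "v \<noteq> []" "u \<noteq> v" "act_edge e T = P @ fire U v @ Q"
    "cancels e T \<longleftrightarrow> cancelable U v"
    by (rule edge_splitE)
  have l: "length P = length p" "length U = length u" using h(3,4) by (auto simp: is_word_def)
  have nc: "\<not> cancelable (map (subst S) U) v"
    using e(5) cancels_split[of "map (subst S) P" p "map (subst S) U" u v q "map (subst S) Q"] l
    unfolding h(1,2) by simp
  have new: "\<not> folds S L" if "L \<in> set (act_edge e T)" for L
  proof (cases "L \<in> set (outs U v)")
    case True
    then show ?thesis using nc by (auto simp: set_outs folds_def)
  next
    case False
    then have "L \<in> set T" using that h(2,9,10) e(4) by (auto simp: fire_not_cancelable)
    then show ?thesis using Cons.prems(5) by blast
  qed
  show ?case
    by (rule Cons.IH[OF e(3) is_word_act_edge[OF e(1,2)]]) (use Cons.prems(3,4,6) m new in auto)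
qed simp

lemma stem_head:
  assumes "is_path \<Sigma> R x \<gamma> y" "is_word b S x" "creating \<gamma> S" "stem U0 v0 (hd S)"
  shows "stem U0 v0 (hd (act \<gamma> S))"
  using assms
proof (induction \<gamma> arbitrary: x S)
  case (Cons e \<gamma>)
  then have e: "e \<in> edges \<Sigma> R" "is_word b S (edge_source e)" "is_path \<Sigma> R (edge_target e) \<gamma> y"
     "\<not> cancels e S" by auto
  obtain p u v q P U Q where h: "e = (p, u, v, q)" "S = P @ U @ Q" "U \<noteq> []" "v \<noteq> []"
    "act_edge e S = P @ fire U v @ Q" "cancels e S \<longleftrightarrow> cancelable U v"
    by (rule edge_splitE[OF e(1,2)]) (rule that)
  have "stem U0 v0 (hd (act_edge e S))"
  proof (cases P)
    case Nil
    then show ?thesis using h e(4) Cons.prems(4) by (simp add: fire_not_cancelable stem.higher)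
  next
    case (Cons L P')
    then show ?thesis using h \<open>stem U0 v0 (hd S)\<close> by simp
  qed
  then show ?case using Cons.IH[OF e(3) is_word_act_edge[OF e(1,2)]] Cons.prems(3) by simp
qed simp

text \<open>Let \<open>S\<close> be the initial word with the cell of \<open>f\<close> glued.  The decorated word of \<open>f # \<delta>\<close> is the
translate by \<open>S\<close> of the word \<open>V\<close> reached by \<open>\<delta>\<close> alone.  Suppose that \<open>f\<close> removes a cell from the
translate but not from \<open>V\<close>.  The first letter of \<open>V\<close> cannot come from a cell: this cell would
survive the translation, as \<open>\<delta>\<close> only glues cells to \<open>S\<close>, in contradiction to \<open>cancelable_lift\<close>.
So it is an initial letter, and the removed cell is the one glued by \<open>f\<close>; but an edge does not
undo itself, as its two sides differ.\<close>
lemma rotation_prevents_cancellation: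
  assumes f: "f = ([], u, v, q)" and path: "is_path \<Sigma> R w (f # \<delta>) w"
    and cr: "creating (f # \<delta>) (start w)" "creating (\<delta> @ [f]) (start (v @ q))"
  shows "\<not> cancels f (act (f # \<delta>) (start w))"
proof
  assume canc: "cancels f (act (f # \<delta>) (start w))"
  define S where "S = act [f] (start w)"
  define V where "V = act \<delta> (start (v @ q))"
  have w: "w = u @ q" and fe: "f \<in> edges \<Sigma> R" and d: "is_path \<Sigma> R (v @ q) \<delta> w"
    using path f by auto
  have pf: "is_path \<Sigma> R w [f] (v @ q)" using path f nullary_path[OF d] by auto
  have uv: "u \<noteq> []" "v \<noteq> []" "u \<noteq> v" using edge_sides(1-3) fe unfolding f by blast+
  have S: "is_word w S (v @ q)" unfolding S_def using pf is_word_start by (rule is_word_act)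
  have V: "is_word (v @ q) V (u @ q)" unfolding V_def using d is_word_start unfolding w by (rule is_word_act)
  obtain U2 Q2 where U2: "V = U2 @ Q2" "is_word (v @ q) U2 u" "is_word (v @ q) Q2 q"
    using V by (rule word_split)
  have l2: "length U2 = length u" "U2 \<noteq> []" "lab U2 = u" using U2(2) uv by (auto simp: is_word_def)
  have nc: "\<not> cancelable U2 v"
    using cr(2) cancels_split[of "[]" "[]" U2 u v q Q2] l2 U2(1)
    unfolding creating_append f V_def[symmetric] by simp
  have mS: "map (subst S) (start (v @ q)) = S"
    using is_word_length[OF S] by (rule map_subst_start)
  have "act (f # \<delta>) (start w) = map (subst S) V"
    using act_eq_map_subst[OF S d] by (simp add: S_def V_def)
  then have c2: "cancelable (map (subst S) U2) v"
    using canc cancels_split[of "[]" "[]" "map (subst S) U2" u v q "map (subst S) Q2"] l2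
    unfolding f U2(1) by simp
  have r: "reduced (v @ q) (hd U2)" using U2(2) l2(2) by (simp add: is_word_def)
  show False
  proof (cases "hd U2")
    case (Out X t i)
    have "\<not> folds S (hd U2)"
    proof (rule creating_no_folds[OF d is_word_start _ _ S])
      show "creating \<delta> (start (v @ q))" using cr(2) by (simp add: creating_append)
      show "creating \<delta> (map (subst S) (start (v @ q)))" unfolding mS using cr(1) by (simp add: S_def)
      show "hd U2 \<in> set (act \<delta> (start (v @ q)))" using U2(1) l2(2) V_def by simp
      show "\<not> folds S L" if "L \<in> set (start (v @ q))" for L
        using start_letter[OF that] by (auto simp: folds_def)
    qed
    then have "\<not> cancelable (map (subst S) X) t" using Out by (simp add: folds_def)
    from cancelable_lift[OF pf U2(2) l2(2) Out, folded S_def, OF this c2]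
    show False using nc by blast
  next
    case (Base i a)
    have "Base i a \<in> set (start (v @ q))" using r Base by simp
    then have i: "i < length (rev S)" using start_letter is_word_length[OF S] by fastforce
    obtain U0 Q0 where U0: "start w = U0 @ Q0" "is_word w U0 u" "is_word w Q0 q"
      using is_word_start[of w] unfolding w by (rule word_split)
    have "length U0 = length u" using U0(2) by (auto simp: is_word_def)
    then have "cancels f (start w) \<longleftrightarrow> cancelable U0 v" "S = fire U0 v @ Q0"
      unfolding S_def f using U0(1) cancels_split[of "[]" "[]" U0 u v q Q0] act_edge_split[of "[]" "[]" U0 u v q Q0]
      by simp_all
    then have S': "S = outs U0 v @ Q0" using cr(1) by (simp add: fire_not_cancelable)
    have "lab (map (subst S) U2) = u" using is_word_subst[OF S U2(2)] by (simp add: is_word_def)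
    then obtain U' where U': "map (subst S) U2 = outs U' u" using c2 unfolding cancelable_def by metis
    have "subst S (hd U2) = Out U' u 0" using U' l2(2) uv(1) by (metis hd_map hd_outs)
    then have "Out U' u 0 \<in> set S" using Base i by (metis nth_mem set_rev subst.simps(1))
    moreover have "Out U' u 0 \<notin> set Q0" using U0(1) start_letter[of "Out U' u 0" w] by auto
    ultimately show False using S' uv(3) by (auto simp: set_outs)
  qed
qed

text \<open>Let \<open>S n\<close> be the decorated word of the \<open>n\<close>-th power and \<open>V = S 1\<close>.  The first letter of
\<open>S (n + 1)\<close> is the translate by \<open>S n\<close> of the first letter of \<open>V\<close>.  No cell in the chain of
leftmost ancestors of the latter is undone by this translation: going down the chain, each cell
survives because the one above it does, and for the topmost cell, that of \<open>f\<close>, this says that \<open>f\<close>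
does not cancel on \<open>S n\<close>.  The latter in turn follows inductively, since \<open>f\<close> does not cancel on
\<open>V\<close>.  So the chain grows by at least one cell with each power.\<close>
lemma linear_growth_at_first_letter:
  assumes f: "f = ([], u, v, q)" and path: "is_path \<Sigma> R w (f # \<delta>) w"
    and cr: "creating (f # \<delta>) (start w)" "\<not> cancels f (act (f # \<delta>) (start w))"
  shows "linear_growth w (f # \<delta>)"
proof -
  define \<gamma> where "\<gamma> = f # \<delta>"
  define V where "V = act \<gamma> (start w)"
  define S where "S n = act (path_power \<gamma> n) (start w)" for n
  have w: "w = u @ q" and fe: "f \<in> edges \<Sigma> R" and d: "is_path \<Sigma> R (v @ q) \<delta> w"
    using path f by auto
  have uv: "u \<noteq> []" "v \<noteq> []" "u \<noteq> v" using edge_sides(1-3) fe unfolding f by blast+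
  have g: "is_path \<Sigma> R w \<gamma> w" using path by (simp add: \<gamma>_def)
  have pp: "is_path \<Sigma> R w (path_power \<gamma> n) w" for n using g by (rule is_path_power)
  have S: "is_word w (S n) w" for n unfolding S_def using pp is_word_start by (rule is_word_act)
  have V: "is_word w V w" unfolding V_def using g is_word_start by (rule is_word_act)
  obtain U0 Q0 where U0: "start w = U0 @ Q0" "is_word w U0 u" "is_word w Q0 q"
    using is_word_start[of w] unfolding w by (rule word_split)
  obtain U1 Q1 where U1: "V = U1 @ Q1" "is_word w U1 u" "is_word w Q1 q"
    using V unfolding w by (rule word_split)
  have l: "length U0 = length u" "length U1 = length u" "U0 \<noteq> []" "U1 \<noteq> []"
    using is_word_length[OF U0(2)] is_word_length[OF U1(2)] uv(1) by auto
  have S0: "map (subst (S n)) (start w) = S n" for n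
    using is_word_length[OF S] by (rule map_subst_start)
  have SSuc: "S (Suc n) = map (subst (S n)) V" for n
    using act_eq_map_subst[OF S[of n] g] unfolding S_def path_power_Suc_right V_def by simp
  have cS: "cancels f (map (subst (S n)) (A @ B)) \<longleftrightarrow> cancelable (map (subst (S n)) A) v"
    if "length A = length u" for A B n
    using cancels_split[of "[]" "[]" "map (subst (S n)) A" u v q "map (subst (S n)) B"] that
    unfolding f by simp
  have nc1: "\<not> cancelable U1 v"
  proof -
    have "\<not> cancels f V" using cr(2) by (simp add: V_def \<gamma>_def)
    then show ?thesis
      using cancels_split[of "[]" "[]" U1 u v q Q1] l(2) unfolding f U1(1) by simp
  qed
  have stemV: "stem U0 v (hd V)"
  proof -
    have "act_edge f (start w) = outs U0 v @ Q0"
      using cr(1) U0(1) l(1) cancels_split[of "[]" "[]" U0 u v q Q0] act_edge_split[of "[]" "[]" U0 u v q Q0]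
      unfolding f by (simp add: fire_not_cancelable)
    then have "stem U0 v (hd (act_edge f (start w)))" using uv(2) by (simp add: stem.first)
    moreover have "is_word w (act_edge f (start w)) (v @ q)"
      using is_word_act_edge[OF fe, of w "start w"] is_word_start[of w] w f by simp
    ultimately have "stem U0 v (hd (act \<delta> (act_edge f (start w))))"
      using stem_head[OF d] cr(1) by simp
    then show ?thesis by (simp add: V_def \<gamma>_def)
  qed
  have hdU1: "hd U1 = hd V" using U1(1) l(4) by simp
  have redV: "reduced w (hd V)" using V U1(1) l(4) by (simp add: is_word_def)
  have no_folds: "\<not> folds (S n) L" if A: "\<not> cancels f (S n)" and "stem U0 v L" "reduced w L" for n L
    using that(2,3)
  proof (induction rule: stem.induct)
    case first
    have "\<not> cancelable (map (subst (S n)) U0) v"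
      using A cS[OF l(1), of n Q0] U0(1) S0[of n] by simp
    then show ?case by (simp add: folds_def)
  next
    case (higher U t)
    have U: "is_word w U (lab U)" "U \<noteq> []" "\<not> cancelable U t" "reduced w (hd U)"
      using higher.prems by (auto simp: is_word_def)
    obtain X t' where X: "hd U = Out X t' 0" using stem_Out[OF higher.hyps] by blast
    have "\<not> cancelable (map (subst (S n)) X) t'"
      using higher.IH[OF U(4)] X by (simp add: folds_def)
    then have "\<not> cancelable (map (subst (S n)) U) t"
      using cancelable_lift[OF pp[of n] U(1,2) X, folded S_def] U(3) by blast
    then show ?case by (simp add: folds_def)
  qed
  have A: "\<not> cancels f (S n)" for n
  proof (induction n)
    case 0
    then show ?case using cr(1) by (simp add: S_def)
  next
    case (Suc n)
    obtain X t where X: "hd U1 = Out X t 0" using stem_Out[OF stemV] hdU1 by auto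
    have "\<not> cancelable (map (subst (S n)) X) t"
      using no_folds[OF Suc stemV redV] X hdU1 by simp
    then have "\<not> cancelable (map (subst (S n)) U1) v"
      using cancelable_lift[OF pp[of n] U1(2) l(4) X, folded S_def] nc1 by blast
    then show ?case unfolding SSuc U1(1) using cS[OF l(2)] by blast
  qed
  have hd_le: "weight (hd T) \<le> cells T" if "T \<noteq> []" for T :: "'a letter list"
    using that by (cases T) auto
  have step: "Suc (weight (hd (S n))) \<le> weight (subst (S n) L)"
    if "stem U0 v L" "reduced w L" for n L
    using that
  proof (induction rule: stem.induct)
    case first
    have "\<not> cancelable (map (subst (S n)) U0) v" 
      using no_folds[OF A stem.first first] by (simp add: folds_def)
    then have "weight (subst (S n) (Out U0 v 0)) = Suc (cells (map (subst (S n)) U0))"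
      using uv(2) by (simp add: fire_not_cancelable)
    moreover have "hd (S n) = hd (map (subst (S n)) U0)"
      using S0[of n] U0(1) l(3) by (metis append_is_Nil_conv hd_append map_append map_is_Nil_conv)
    ultimately show ?case using hd_le[of "map (subst (S n)) U0"] l(3) by simp
  next
    case (higher U t)
    have U: "U \<noteq> []" "reduced w (hd U)" "0 < length t" using higher.prems by auto
    have "\<not> cancelable (map (subst (S n)) U) t"
      using no_folds[OF A stem.higher[OF higher.hyps] higher.prems] by (simp add: folds_def)
    then have "weight (subst (S n) (Out U t 0)) = Suc (cells (map (subst (S n)) U))"
      using U(3) by (simp add: fire_not_cancelable)
    then show ?case
      using higher.IH[OF U(2)] hd_le[of "map (subst (S n)) U"] U(1) by (simp add: hd_map)
  qed
  have W: "n \<le> weight (hd (S n))" for n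
  proof (induction n)
    case (Suc n)
    have "hd (S (Suc n)) = subst (S n) (hd V)"
      unfolding SSuc using U1(1) l(4) by (simp add: hd_map)
    then show ?case using step[OF stemV redV, of n] Suc by simp
  qed simp
  have "n \<le> length \<epsilon>" if h: "homotopic \<Sigma> R w w (path_power \<gamma> n) \<epsilon>" for n \<epsilon>
  proof -
    have "S n \<noteq> []" using S[of n] w uv(1) by (auto simp: is_word_def)
    then have "n \<le> cells (S n)" using W[of n] hd_le[of "S n"] by simp
    also have "S n = act \<epsilon> (start w)" unfolding S_def using h is_word_start by (rule act_homotopic)
    also have "cells (act \<epsilon> (start w)) \<le> length \<epsilon>"
      using cells_act_le[OF _ is_word_start] homotopic_is_path[OF h] by fastforce
    finally show ?thesis .
  qed
  then show ?thesis unfolding linear_growth_def \<gamma>_def by (metis add.right_neutral)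
qed

text \<open>The outer induction on the length of the loop serves the cases in which a rotation of it can be
shortened.  The inner induction on the base word serves the case in which the first letter is
never touched and can be dropped.\<close>
theorem nontrivial_linear_growth:
  assumes "is_path \<Sigma> R w \<gamma> w" "\<not> homotopic \<Sigma> R w w \<gamma> []"
  shows "linear_growth w \<gamma>"
proof -
  have "linear_growth w \<gamma>" if "length \<gamma> = n" "is_path \<Sigma> R w \<gamma> w" "\<not> homotopic \<Sigma> R w w \<gamma> []" for n
    using that
  proof (induction n arbitrary: \<gamma> w rule: less_induct)
    case (less n)
    have not_creating: "linear_growth x \<delta>"
      if loop: "is_path \<Sigma> R x \<delta> x" "length \<delta> = n" "\<not> homotopic \<Sigma> R x x \<delta> []" "\<not> creating \<delta> (start x)" for x \<delta>
    proof -
      obtain \<epsilon> where e: "homotopic \<Sigma> R x x \<delta> \<epsilon>" "length \<epsilon> < n"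
        using creating_representative[OF loop(1)] loop(2,4) by blast
      have "is_path \<Sigma> R x \<epsilon> x" "\<not> homotopic \<Sigma> R x x \<epsilon> []"
        using e(1) homotopic_is_path loop(3) by (blast intro: homotopic.trans)+
      then show ?thesis using less.IH[OF e(2)] linear_growth_homotopic[OF e(1)] by blast
    qed
    from less.prems show ?case
    proof (induction w arbitrary: \<gamma>)
      case Nil
      then show ?case using is_path_start by fastforce
    next
      case (Cons a w)
      show ?case
      proof (cases "\<exists>e\<in>set \<gamma>. fst e = []")
        case False
        have "homotopic \<Sigma> R (a # w) (a # w) [] []"
          using nullary_path[OF Cons.prems(2)] homotopic.refl by blast
        then have "\<gamma> \<noteq> []" using Cons.prems(3) by auto
        then obtain e \<gamma>1 where g: "\<gamma> = e # \<gamma>1" by (cases \<gamma>) auto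
        have w: "w \<noteq> []" and a: "a \<in> \<Sigma>"
        proof -
          obtain p u v q where e: "e = (p, u, v, q)" by (metis prod.exhaust)
          have "p @ u @ q = a # w" "(p, u, v, q) \<in> edges \<Sigma> R" "a # w \<in> lists \<Sigma>"
            using Cons.prems(2) g e by auto
          then show "w \<noteq> []" "a \<in> \<Sigma>" using edge_sides(1)[of p u v q] False g e by (cases p; auto)+
        qed
        obtain \<gamma>' where g': "\<gamma> = map (shift a) \<gamma>'" "is_path \<Sigma> R w \<gamma>' w"
          using path_without_left_edges[OF Cons.prems(2) w] False by auto
        have "\<not> homotopic \<Sigma> R w w \<gamma>' []"
          using homotopic_shift[of w w \<gamma>' "[]" a] a Cons.prems(3) g'(1) by auto
        then have "linear_growth w \<gamma>'" using Cons.IH Cons.prems(1) g' by simp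
        then show ?thesis using linear_growth_shift[OF g'(2)] g'(1) by simp
      next
        case True
        then obtain \<beta> f \<delta> where g: "\<gamma> = \<beta> @ f # \<delta>" "fst f = []"
          by (metis split_list)
        obtain u v q where f: "f = ([], u, v, q)" using g(2) by (metis prod.collapse)
        \<comment> \<open>The rotation \<open>f # \<rho>\<close> of \<open>\<gamma>\<close> starts at the first letter of its base word.\<close>
        define \<rho> where "\<rho> = \<delta> @ \<beta>"
        obtain z where z: "is_path \<Sigma> R (a # w) \<beta> z" "is_path \<Sigma> R z (f # \<delta>) (a # w)"
          using Cons.prems(2) unfolding g(1) is_path_append by blast
        have zz: "is_path \<Sigma> R z (f # \<rho>) z"
          using z is_path_append[of \<Sigma> R z "f # \<delta>" \<beta> z] by (auto simp: \<rho>_def)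
        have len: "length (f # \<rho>) = n" "length (\<rho> @ [f]) = n"
          using Cons.prems(1) g(1) by (auto simp: \<rho>_def)
        have pf: "is_path \<Sigma> R z [f] (v @ q)" "is_path \<Sigma> R (v @ q) \<rho> z"
          using zz f nullary_path[of "v @ q" \<rho> z] by auto
        have yy: "is_path \<Sigma> R (v @ q) (\<rho> @ [f]) (v @ q)" using pf is_path_append by blast
        have nz: "\<not> homotopic \<Sigma> R z z (f # \<rho>) []"
          using null_homotopic_rotate[OF z, unfolded \<rho>_def] Cons.prems(3) unfolding g(1) \<rho>_def by auto
        have ny: "\<not> homotopic \<Sigma> R (v @ q) (v @ q) (\<rho> @ [f]) []"
          using null_homotopic_rotate[OF pf] nz by auto
        have "linear_growth z (f # \<rho>)"
        proof (cases "creating (f # \<rho>) (start z)")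
          case False
          then show ?thesis using not_creating[OF zz len(1) nz] by blast
        next
          case c1: True
          show ?thesis
          proof (cases "creating (\<rho> @ [f]) (start (v @ q))")
            case False
            then have "linear_growth (v @ q) (\<rho> @ [f])" using not_creating[OF yy len(2) ny] by blast
            then show ?thesis using linear_growth_rotate[OF pf] by simp
          next
            case True
            then show ?thesis
              using rotation_prevents_cancellation[OF f zz c1] linear_growth_at_first_letter[OF f zz c1]
              by blast
          qed
        qed
        then show ?thesis using linear_growth_rotate[OF z] g(1) by (simp add: \<rho>_def)
      qed
    qed
  qed
  then show ?thesis using assms by blast
qed

end

section \<open>Central commutators\<close>

lemma (in group) pow_swap:
  assumes "a \<in> carrier G" "y \<in> carrier G" "z \<in> carrier G"
    and "a \<otimes> y = z \<otimes> (y \<otimes> a)" "z \<otimes> y = y \<otimes> z"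
  shows "a \<otimes> y [^] (m :: nat) = z [^] m \<otimes> (y [^] m \<otimes> a)"
proof (induction m)
  case (Suc m)
  have c: "y [^] m \<otimes> z = z \<otimes> y [^] m"
    using group_commutes_pow[of y z m] assms by simp
  have "a \<otimes> y [^] Suc m = (a \<otimes> y [^] m) \<otimes> y" using assms by (simp add: m_assoc)
  also have "\<dots> = z [^] m \<otimes> (y [^] m \<otimes> (a \<otimes> y))" using Suc assms(1-3) by (simp add: m_assoc)
  also have "\<dots> = z [^] m \<otimes> ((y [^] m \<otimes> z) \<otimes> (y \<otimes> a))" using assms by (simp add: m_assoc)
  also have "\<dots> = z [^] Suc m \<otimes> (y [^] Suc m \<otimes> a)" unfolding c using assms(1-3) by (simp add: m_assoc)
  finally show ?case .
qed (use assms in simp)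

lemma (in group) pow_commutator:
  assumes "x \<in> carrier G" "y \<in> carrier G" "z \<in> carrier G"
    and "x \<otimes> y = z \<otimes> (y \<otimes> x)" "z \<otimes> x = x \<otimes> z" "z \<otimes> y = y \<otimes> z"
  shows "x [^] (n :: nat) \<otimes> y [^] (n :: nat) = z [^] (n * n) \<otimes> (y [^] n \<otimes> x [^] n)"
proof -
  have 1: "x [^] n \<otimes> y = z [^] n \<otimes> (y \<otimes> x [^] n)"
  proof (induction n)
    case (Suc n)
    have c: "x [^] n \<otimes> z = z \<otimes> x [^] n"
      using group_commutes_pow[of x z n] assms by simp
    have "x [^] Suc n \<otimes> y = (x [^] n \<otimes> z) \<otimes> (y \<otimes> x)" using assms by (simp add: m_assoc)
    also have "\<dots> = z \<otimes> ((x [^] n \<otimes> y) \<otimes> x)" unfolding c using assms(1-3) by (simp add: m_assoc)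
    also have "\<dots> = (z \<otimes> z [^] n) \<otimes> (y \<otimes> (x [^] n \<otimes> x))" unfolding Suc using assms(1-3) by (simp add: m_assoc)
    also have "z \<otimes> z [^] n = z [^] Suc n" using assms(3) by (simp only: nat_pow_Suc2)
    finally show ?case using assms(1-3) by simp
  qed (use assms in simp)
  have "z [^] n \<otimes> y = y \<otimes> z [^] n" using group_commutes_pow assms by blast
  then have "x [^] n \<otimes> y [^] n = (z [^] n) [^] n \<otimes> (y [^] n \<otimes> x [^] n)"
    using 1 assms(1-3) by (intro pow_swap) simp_all
  then show ?thesis using nat_pow_pow[OF assms(3)] by simp
qed

text \<open>If the lower central series reaches the trivial group after \<open>k + 2\<close> steps and no earlier, then the
commutators generating its term \<open>k + 1\<close> are central and one of them is nontrivial.  At least two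
steps are needed as the group is not abelian.\<close>
lemma nilpotent_not_commutative:
  fixes K (structure)
  assumes "nilpotent_group K" "\<not> comm_group K"
  obtains h g z where "h \<in> carrier K" "g \<in> carrier K" "z \<in> carrier K" "h \<otimes> g = z \<otimes> (g \<otimes> h)" "z \<noteq> \<one>"
    "\<forall>k\<in>carrier K. z \<otimes> k = k \<otimes> z"
proof -
  interpret group K using assms(1) by (simp add: nilpotent_group_def)
  define comm where "comm h g = h \<otimes> g \<otimes> inv h \<otimes> inv g" for h g
  have comm_closed: "comm h g \<in> carrier K" if "h \<in> carrier K" "g \<in> carrier K" for h g
    using that by (simp add: comm_def)
  have comm: "h \<otimes> g = comm h g \<otimes> (g \<otimes> h)" if "h \<in> carrier K" "g \<in> carrier K" for h g
    using that by (simp add: comm_def m_assoc) (simp flip: m_assoc)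
  let ?L = "lower_central_series K"
  have LSuc: "?L (Suc n) = generate K {comm h g | h g. h \<in> ?L n \<and> g \<in> carrier K}" for n
    by (simp add: comm_def)
  have L_carrier: "?L n \<subseteq> carrier K" for n
  proof (induction n)
    case (Suc n)
    then show ?case unfolding LSuc using comm_closed by (intro generate_incl) blast
  qed simp
  have comm_in: "comm h g \<in> ?L (Suc n)" if "h \<in> ?L n" "g \<in> carrier K" for h g n
    unfolding LSuc using that by (blast intro: generate.incl)
  define m where "m = (LEAST n. ?L n = {\<one>})"
  have m: "?L m = {\<one>}"
    using assms(1) LeastI_ex[of "\<lambda>n. ?L n = {\<one>}"] unfolding nilpotent_group_def m_def by simp
  have less: "?L k \<noteq> {\<one>}" if "k < m" for k using not_less_Least[OF that[unfolded m_def]] .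
  obtain x y where xy: "x \<in> carrier K" "y \<in> carrier K" "x \<otimes> y \<noteq> y \<otimes> x"
    using assms(2) group_comm_groupI by blast
  have "comm x y \<noteq> \<one>" using comm[OF xy(1,2)] xy by auto
  then have "?L 0 \<noteq> {\<one>}" "?L (Suc 0) \<noteq> {\<one>}"
    using comm_closed[OF xy(1,2)] comm_in[of x 0 y] xy(1,2) by (auto simp del: lower_central_series.simps(2))
  then obtain k where k: "m = Suc (Suc k)" using m by (metis not0_implies_Suc)
  have "\<exists>h\<in>?L k. \<exists>g\<in>carrier K. comm h g \<noteq> \<one>"
  proof (rule ccontr)
    assume "\<not> ?thesis"
    then have "{comm h g | h g. h \<in> ?L k \<and> g \<in> carrier K} \<subseteq> {\<one>}" by blast
    then have "?L (Suc k) \<subseteq> generate K {\<one>}" unfolding LSuc by (rule mono_generate)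
    then have "?L (Suc k) = {\<one>}" using generate_one LSuc generate.one by blast
    then show False using less[of "Suc k"] k by simp
  qed
  then obtain h g where hg: "h \<in> ?L k" "g \<in> carrier K" "comm h g \<noteq> \<one>" by blast
  have h: "h \<in> carrier K" using hg(1) L_carrier by blast
  have "\<forall>l\<in>carrier K. comm h g \<otimes> l = l \<otimes> comm h g"
  proof
    fix l assume l: "l \<in> carrier K"
    have "comm (comm h g) l = \<one>" using comm_in[OF comm_in[OF hg(1,2)] l] m k by simp
    then show "comm h g \<otimes> l = l \<otimes> comm h g" using comm[OF comm_closed[OF h hg(2)] l] l comm_closed[OF h hg(2)] by simp
  qed
  then show ?thesis using that[OF h hg(2) comm_closed[OF h hg(2)] comm[OF h hg(2)] hg(3)] by blast
qed

lemma length_path_power [simp]: "length (path_power \<gamma> n) = n * length \<gamma>"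
  by (induction n) auto

context presentation begin

text \<open>The \<open>n * n\<close>-th power of a nontrivial \<open>Z\<close> would have length at least \<open>n * n - k\<close>, but it is the
commutator of the \<open>n\<close>-th powers of \<open>X\<close> and \<open>Y\<close>, whose length is linear in \<open>n\<close>.\<close>
lemma central_commutator_trivial:
  assumes w: "w \<in> free_semigroup \<Sigma>"
    and "X \<in> carrier (diagram_group \<Sigma> R w)" "Y \<in> carrier (diagram_group \<Sigma> R w)" "Z \<in> carrier (diagram_group \<Sigma> R w)"
    and eq: "X \<otimes>\<^bsub>diagram_group \<Sigma> R w\<^esub> Y = Z \<otimes>\<^bsub>diagram_group \<Sigma> R w\<^esub> (Y \<otimes>\<^bsub>diagram_group \<Sigma> R w\<^esub> X)"
    "Z \<otimes>\<^bsub>diagram_group \<Sigma> R w\<^esub> X = X \<otimes>\<^bsub>diagram_group \<Sigma> R w\<^esub> Z"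
    "Z \<otimes>\<^bsub>diagram_group \<Sigma> R w\<^esub> Y = Y \<otimes>\<^bsub>diagram_group \<Sigma> R w\<^esub> Z"
  shows "Z = \<one>\<^bsub>diagram_group \<Sigma> R w\<^esub>"
proof -
  define D where "D = diagram_group \<Sigma> R w"
  define c where "c \<gamma> = homotopy_rel \<Sigma> R w `` {\<gamma>}" for \<gamma>
  interpret D: group D unfolding D_def using w by (rule group_diagram_group)
  obtain \<xi> where X: "is_path \<Sigma> R w \<xi> w" "X = c \<xi>" using assms(2) unfolding c_def by (rule diagram_group_carrierE)
  obtain \<eta> where Y: "is_path \<Sigma> R w \<eta> w" "Y = c \<eta>" using assms(3) unfolding c_def by (rule diagram_group_carrierE)
  obtain \<zeta> where Z: "is_path \<Sigma> R w \<zeta> w" "Z = c \<zeta>" using assms(4) unfolding c_def by (rule diagram_group_carrierE)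
  have one: "\<one>\<^bsub>D\<^esub> = c []" by (simp add: D_def c_def diagram_group_def)
  have app: "is_path \<Sigma> R w (\<gamma> @ \<delta>) w" if "is_path \<Sigma> R w \<gamma> w" "is_path \<Sigma> R w \<delta> w" for \<gamma> \<delta>
    using that is_path_append by blast
  have mult: "c \<gamma> \<otimes>\<^bsub>D\<^esub> c \<delta> = c (\<gamma> @ \<delta>)" if "is_path \<Sigma> R w \<gamma> w" "is_path \<Sigma> R w \<delta> w" for \<gamma> \<delta>
    unfolding D_def c_def using that by (rule diagram_group_mult_class)
  have carr: "c \<gamma> \<in> carrier D" if "is_path \<Sigma> R w \<gamma> w" for \<gamma>
    unfolding D_def c_def using that by (rule diagram_group_class_in_carrier)
  have eq_iff: "c \<gamma> = c \<delta> \<longleftrightarrow> homotopic \<Sigma> R w w \<gamma> \<delta>" if "is_path \<Sigma> R w \<gamma> w" "is_path \<Sigma> R w \<delta> w" for \<gamma> \<delta>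
    unfolding c_def using eq_equiv_class_iff[OF equiv_homotopy_rel, of \<gamma> \<Sigma> R w \<delta>] that
    by (simp add: homotopy_rel_def)
  have pow: "c \<gamma> [^]\<^bsub>D\<^esub> n = c (path_power \<gamma> n)" if "is_path \<Sigma> R w \<gamma> w" for \<gamma> and n :: nat
  proof (induction n)
    case (Suc n)
    then show ?case using mult[OF is_path_power[OF that] that] by (simp add: path_power_Suc_right del: path_power_simps)
  qed (simp add: one)
  have inv: "inv\<^bsub>D\<^esub> (c \<gamma>) = c (path_inverse \<gamma>)" if g: "is_path \<Sigma> R w \<gamma> w" for \<gamma>
  proof (rule D.inv_equality)
    have i: "is_path \<Sigma> R w (path_inverse \<gamma>) w" using g by (rule is_path_inverse)
    show "c (path_inverse \<gamma>) \<otimes>\<^bsub>D\<^esub> c \<gamma> = \<one>\<^bsub>D\<^esub>"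
      unfolding mult[OF i g] one using eq_iff[OF app[OF i g]] homotopic_inverse_left[OF g] w by simp
    show "c (path_inverse \<gamma>) \<in> carrier D" "c \<gamma> \<in> carrier D" using carr g i by auto
  qed
  show ?thesis
  proof (rule ccontr)
    assume "Z \<noteq> \<one>\<^bsub>diagram_group \<Sigma> R w\<^esub>"
    then have "\<not> homotopic \<Sigma> R w w \<zeta> []" using eq_iff[OF Z(1), of "[]"] one Z(2) w by (simp add: D_def)
    then have "linear_growth w \<zeta>" using Z(1) by (intro nontrivial_linear_growth)
    then obtain k where k: "\<And>n \<delta>. homotopic \<Sigma> R w w (path_power \<zeta> n) \<delta> \<Longrightarrow> n \<le> length \<delta> + k"
      unfolding linear_growth_def by blast
    have bound: "n * n \<le> n * (2 * (length \<xi> + length \<eta>)) + k" for n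
    proof -
      define \<alpha> \<beta> where "\<alpha> = path_power \<xi> n @ path_power \<eta> n" and "\<beta> = path_power \<eta> n @ path_power \<xi> n"
      have "is_path \<Sigma> R w (path_power \<xi> n) w" "is_path \<Sigma> R w (path_power \<eta> n) w"
        using is_path_power[OF X(1)] is_path_power[OF Y(1)] by blast+
      then have p: "is_path \<Sigma> R w \<alpha> w" "is_path \<Sigma> R w \<beta> w"
        unfolding \<alpha>_def \<beta>_def using app by blast+
      then have pinv: "is_path \<Sigma> R w (path_inverse \<beta>) w" by (intro is_path_inverse)
      have z: "is_path \<Sigma> R w (path_power \<zeta> (n * n)) w" using Z(1) by (rule is_path_power)
      have "X [^]\<^bsub>D\<^esub> n \<otimes>\<^bsub>D\<^esub> Y [^]\<^bsub>D\<^esub> n = Z [^]\<^bsub>D\<^esub> (n * n) \<otimes>\<^bsub>D\<^esub> (Y [^]\<^bsub>D\<^esub> n \<otimes>\<^bsub>D\<^esub> X [^]\<^bsub>D\<^esub> n)"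
        using assms(2-4) eq unfolding D_def[symmetric] by (rule D.pow_commutator)
      then have "c \<alpha> = c (path_power \<zeta> (n * n)) \<otimes>\<^bsub>D\<^esub> c \<beta>"
        unfolding X(2) Y(2) Z(2) pow[OF X(1)] pow[OF Y(1)] pow[OF Z(1)] \<alpha>_def \<beta>_def
        by (simp add: mult is_path_power X(1) Y(1))
      then have "c (path_power \<zeta> (n * n)) = c \<alpha> \<otimes>\<^bsub>D\<^esub> inv\<^bsub>D\<^esub> (c \<beta>)"
        using D.inv_solve_right'[of "c (path_power \<zeta> (n * n))" "c \<alpha>" "c \<beta>"] carr p z by simp
      also have "\<dots> = c (\<alpha> @ path_inverse \<beta>)" using inv[OF p(2)] mult[OF p(1) pinv] by simp
      finally have "homotopic \<Sigma> R w w (path_power \<zeta> (n * n)) (\<alpha> @ path_inverse \<beta>)"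
        using eq_iff[OF z app[OF p(1) pinv]] by simp
      from k[OF this] show ?thesis by (simp add: \<alpha>_def \<beta>_def path_inverse_def algebra_simps)
    qed
    \<comment> \<open>For this exponent, the square exceeds the linear bound on the length of the commutator.\<close>
    define N where "N = 2 * (length \<xi> + length \<eta>) + Suc k"
    have "N * N = N * (2 * (length \<xi> + length \<eta>)) + N * Suc k" by (simp add: N_def algebra_simps)
    moreover have "N * Suc k \<ge> Suc k" by (simp add: N_def)
    ultimately show False using bound[of N] by linarith
  qed
qed

end

theorem corollary15:
  fixes \<Sigma> :: "'a set" and R :: "('a list \<times> 'a list) set" and w :: "'a list"
    and G :: "('g, 'b) monoid_scheme" and H :: "'g set"
  assumes "semigroup_presentation \<Sigma> R"
    and "w \<in> free_semigroup \<Sigma>"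
    and "group G"
    and "G \<cong> diagram_group \<Sigma> R w"
    and "subgroup H G"
    and "nilpotent_group (G\<lparr>carrier := H\<rparr>)"
  shows "comm_group (G\<lparr>carrier := H\<rparr>)"
proof (rule ccontr)
  let ?K = "G\<lparr>carrier := H\<rparr>" and ?D = "diagram_group \<Sigma> R w"
  interpret presentation \<Sigma> R using assms(1) by (rule presentation.intro)
  interpret D: group ?D using assms(2) by (rule group_diagram_group)
  interpret G: group G by (rule assms(3))
  assume "\<not> comm_group ?K"
  with assms(6) obtain h g z where "h \<in> carrier ?K" "g \<in> carrier ?K" "z \<in> carrier ?K"
    "h \<otimes>\<^bsub>?K\<^esub> g = z \<otimes>\<^bsub>?K\<^esub> (g \<otimes>\<^bsub>?K\<^esub> h)" "z \<noteq> \<one>\<^bsub>?K\<^esub>"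
    "\<forall>k\<in>carrier ?K. z \<otimes>\<^bsub>?K\<^esub> k = k \<otimes>\<^bsub>?K\<^esub> z"
    by (rule nilpotent_not_commutative)
  then have H: "h \<in> H" "g \<in> H" "z \<in> H" and eq: "h \<otimes>\<^bsub>G\<^esub> g = z \<otimes>\<^bsub>G\<^esub> (g \<otimes>\<^bsub>G\<^esub> h)" "z \<noteq> \<one>\<^bsub>G\<^esub>"
    and central: "z \<otimes>\<^bsub>G\<^esub> h = h \<otimes>\<^bsub>G\<^esub> z" "z \<otimes>\<^bsub>G\<^esub> g = g \<otimes>\<^bsub>G\<^esub> z"
    by simp_all
  have G: "h \<in> carrier G" "g \<in> carrier G" "z \<in> carrier G" using H subgroup.subset[OF assms(5)] by auto
  obtain \<phi> where \<phi>: "\<phi> \<in> iso G ?D" using assms(4) unfolding is_iso_def by blast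
  then have hom: "\<phi> \<in> hom G ?D" and inj: "inj_on \<phi> (carrier G)"
    unfolding iso_def bij_betw_def by auto
  have "\<phi> z = \<one>\<^bsub>?D\<^esub>"
  proof (rule central_commutator_trivial[OF assms(2), of "\<phi> h" "\<phi> g"])
    show "\<phi> h \<in> carrier ?D" "\<phi> g \<in> carrier ?D" "\<phi> z \<in> carrier ?D"
      using hom_in_carrier[OF hom] G by auto
    show "\<phi> h \<otimes>\<^bsub>?D\<^esub> \<phi> g = \<phi> z \<otimes>\<^bsub>?D\<^esub> (\<phi> g \<otimes>\<^bsub>?D\<^esub> \<phi> h)"
      using eq(1) G hom_mult[OF hom] by (metis G.m_closed)
    show "\<phi> z \<otimes>\<^bsub>?D\<^esub> \<phi> h = \<phi> h \<otimes>\<^bsub>?D\<^esub> \<phi> z" "\<phi> z \<otimes>\<^bsub>?D\<^esub> \<phi> g = \<phi> g \<otimes>\<^bsub>?D\<^esub> \<phi> z"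
      using central G hom_mult[OF hom] by metis+
  qed
  then have "\<phi> z = \<phi> \<one>\<^bsub>G\<^esub>" using hom_one[OF hom assms(3) D.group_axioms] by simp
  then have "z = \<one>\<^bsub>G\<^esub>" using inj_onD[OF inj] G(3) by auto
  then show False using eq(2) by simp
qed

end
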